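(* On any non-coKähler $(\kappa,\mu)$-almost coKähler manifold $M(\varphi,\xi,\eta,g)$, the Reeb vector field $\xi$ cannot be mixed Killing.
   Context: A vector field $V$ on a (semi-)Riemannian manifold $(M,g)$ is a mixed Killing vector field if there exists a non-zero smooth function $f$ on $M$ such that $L_VL_Vg=fL_Vg$, where $L_V$ is the Lie derivative along $V$. An almost contact metric manifold $M^{2n+1}(\varphi,\xi,\eta,g)$ ($n\ge 1$) is a Riemannian manifold $(M,g)$ of dimension $2n+1$ with a vector field $\xi$ (the Reeb vector field), a global 1-form $\eta$ and a $(1,1)$ tensor field $\varphi$ such that for all vector fields $X,Y$: $\varphi^2Y=-Y+\eta(Y)\xi$, $\eta(\xi)=1$, $g(\varphi X,\varphi Y)=g(X,Y)-\eta(X)\eta(Y)$. Its fundamental 2-form is $\Phi(X,Y)=g(X,\varphi Y)$. It is almost coKähler if $d\eta=0$ and $d\Phi=0$. On it one defines $h=\frac12L_\xi\varphi$. An almost coKähler manifold is a $(\kappa,\mu)$-almost coKähler manifold, for smooth functions $\kappa,\mu$, if its Riemann curvature tensor $R(X,Y)=[\nabla_X,\nabla_Y]-\nabla_{[X,Y]}$ satisfies $R(X,Y)\xi=\kappa(\eta(Y)X-\eta(X)Y)+\mu(\eta(Y)hX-\eta(X)hY)$ for all vector fields $X,Y$. On such a manifold $h^2=\kappa\varphi^2$, so $\kappa\le 0$; it is called non-coKähler if $\kappa<0$. *)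

theory Defs
  imports "HOL-Analysis.Analysis" "HOL-Library.Function_Algebras"
begin

section \<open>Smooth maps between open subsets of normed spaces\<close>

text \<open>Intended for an open set \<open>S\<close>; in finite dimension this is the usual \<open>C\<^sup>k\<close> condition.\<close>

primrec Ck_on :: "nat \<Rightarrow> 'a::real_normed_vector set \<Rightarrow> ('a \<Rightarrow> 'b::real_normed_vector) \<Rightarrow> bool" where
  "Ck_on 0 S f \<longleftrightarrow> continuous_on S f"
| "Ck_on (Suc k) S f \<longleftrightarrow>
     (\<forall>x\<in>S. f differentiable (at x)) \<and> (\<forall>v. Ck_on k S (\<lambda>x. frechet_derivative f (at x) v))"

definition smooth_on :: "'a::real_normed_vector set \<Rightarrow> ('a \<Rightarrow> 'b::real_normed_vector) \<Rightarrow> bool" where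
  "smooth_on S f \<longleftrightarrow> (\<forall>k. Ck_on k S f)"


section \<open>Smooth manifolds\<close>

text \<open>A chart is a pair of its domain and its coordinate map. The atlas need not be maximal.
  The dimension is \<open>DIM('e)\<close>.\<close>

record ('m, 'e) atlas_space =
  space_top :: "'m topology"
  charts :: "('m set \<times> ('m \<Rightarrow> 'e)) set"

definition pts :: "('m, 'e) atlas_space \<Rightarrow> 'm set" where
  "pts M = topspace (space_top M)"

definition smooth_manifold :: "('m, 'e::euclidean_space) atlas_space \<Rightarrow> bool" where
  "smooth_manifold M \<longleftrightarrow>
     Hausdorff_space (space_top M) \<and> second_countable (space_top M) \<and>
     (\<Union>(U, c)\<in>charts M. U) = pts M \<and>
     (\<forall>(U, c)\<in>charts M. openin (space_top M) U \<and> open (c ` U) \<and>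
        homeomorphic_map (subtopology (space_top M) U) (top_of_set (c ` U)) c) \<and>
     (\<forall>(U, c)\<in>charts M. \<forall>(V, d)\<in>charts M. smooth_on (c ` (U \<inter> V)) (d \<circ> inv_into U c))"

text \<open>The values of a smooth function outside \<open>pts M\<close> are unconstrained; two such functions
  represent the same element of \<open>C\<^sup>\<infinity>(M)\<close> when they agree on \<open>pts M\<close>.\<close>

definition smooth_functions :: "('m, 'e::euclidean_space) atlas_space \<Rightarrow> ('m \<Rightarrow> real) set" where
  "smooth_functions M = {f. \<forall>(U, c)\<in>charts M. smooth_on (c ` U) (f \<circ> inv_into U c)}"

text \<open>Tangent vectors at \<open>p\<close> are the derivations at \<open>p\<close> of the algebra of smooth functions. They are
  set to \<open>0\<close> on functions that are not smooth, so that equality of tangent vectors is equality in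
  HOL. The Leibniz rule makes \<open>v f\<close> independent of the values of \<open>f\<close> outside \<open>pts M\<close>
  (take the product with the indicator function of \<open>pts M\<close>).\<close>

type_synonym 'm tangent = "('m \<Rightarrow> real) \<Rightarrow> real"

definition tangent_space :: "('m, 'e::euclidean_space) atlas_space \<Rightarrow> 'm \<Rightarrow> 'm tangent set" where
  "tangent_space M p = {v.
     (\<forall>f. f \<notin> smooth_functions M \<longrightarrow> v f = 0) \<and>
     (\<forall>f\<in>smooth_functions M. \<forall>g\<in>smooth_functions M. \<forall>a b.
        v (\<lambda>q. a * f q + b * g q) = a * v f + b * v g) \<and>
     (\<forall>f\<in>smooth_functions M. \<forall>g\<in>smooth_functions M.
        v (\<lambda>q. f q * g q) = v f * g p + f p * v g)}"


section \<open>Vector fields and tensor fields\<close>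

type_synonym 'm vfield = "'m \<Rightarrow> 'm tangent"

definition vector_fields :: "('m, 'e::euclidean_space) atlas_space \<Rightarrow> 'm vfield set" where
  "vector_fields M = {X.
     (\<forall>p\<in>pts M. X p \<in> tangent_space M p) \<and>
     (\<forall>p. p \<notin> pts M \<longrightarrow> X p = 0) \<and>
     (\<forall>f\<in>smooth_functions M. (\<lambda>p. X p f) \<in> smooth_functions M)}"

definition vf_scale :: "('m \<Rightarrow> real) \<Rightarrow> 'm vfield \<Rightarrow> 'm vfield" (infixr \<open>*\<^sub>v\<close> 75) where
  "a *\<^sub>v X = (\<lambda>p f. a p * X p f)"

definition vf_app :: "'m vfield \<Rightarrow> ('m \<Rightarrow> real) \<Rightarrow> 'm \<Rightarrow> real" where
  "vf_app X f = (\<lambda>p. X p f)"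

definition lie_bracket :: "'m vfield \<Rightarrow> 'm vfield \<Rightarrow> 'm vfield" where
  "lie_bracket X Y = (\<lambda>p f. X p (vf_app Y f) - Y p (vf_app X f))"

text \<open>Tensor fields are \<open>C\<^sup>\<infinity>(M)\<close>-multilinear maps on the module of vector fields.
  (Vector fields vanish outside \<open>pts M\<close>, so they may be compared by HOL equality; functions are
  compared on \<open>pts M\<close>.)\<close>

definition one_form :: "('m, 'e::euclidean_space) atlas_space \<Rightarrow> ('m vfield \<Rightarrow> 'm \<Rightarrow> real) \<Rightarrow> bool" where
  "one_form M \<alpha> \<longleftrightarrow>
     (\<forall>X\<in>vector_fields M. \<alpha> X \<in> smooth_functions M) \<and>
     (\<forall>X\<in>vector_fields M. \<forall>Y\<in>vector_fields M. \<forall>p\<in>pts M. \<alpha> (X + Y) p = \<alpha> X p + \<alpha> Y p) \<and>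
     (\<forall>a\<in>smooth_functions M. \<forall>X\<in>vector_fields M. \<forall>p\<in>pts M. \<alpha> (a *\<^sub>v X) p = a p * \<alpha> X p)"

definition tensor02 ::
  "('m, 'e::euclidean_space) atlas_space \<Rightarrow> ('m vfield \<Rightarrow> 'm vfield \<Rightarrow> 'm \<Rightarrow> real) \<Rightarrow> bool" where
  "tensor02 M T \<longleftrightarrow>
     (\<forall>X\<in>vector_fields M. one_form M (T X)) \<and> (\<forall>Y\<in>vector_fields M. one_form M (\<lambda>X. T X Y))"

definition tensor11 :: "('m, 'e::euclidean_space) atlas_space \<Rightarrow> ('m vfield \<Rightarrow> 'm vfield) \<Rightarrow> bool" where
  "tensor11 M \<phi> \<longleftrightarrow>
     (\<forall>X\<in>vector_fields M. \<phi> X \<in> vector_fields M) \<and>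
     (\<forall>X\<in>vector_fields M. \<forall>Y\<in>vector_fields M. \<phi> (X + Y) = \<phi> X + \<phi> Y) \<and>
     (\<forall>a\<in>smooth_functions M. \<forall>X\<in>vector_fields M. \<phi> (a *\<^sub>v X) = a *\<^sub>v \<phi> X)"

definition lie_deriv02 ::
  "'m vfield \<Rightarrow> ('m vfield \<Rightarrow> 'm vfield \<Rightarrow> 'm \<Rightarrow> real) \<Rightarrow> 'm vfield \<Rightarrow> 'm vfield \<Rightarrow> 'm \<Rightarrow> real" where
  "lie_deriv02 V T X Y = vf_app V (T X Y) - T (lie_bracket V X) Y - T X (lie_bracket V Y)"

definition lie_deriv11 :: "'m vfield \<Rightarrow> ('m vfield \<Rightarrow> 'm vfield) \<Rightarrow> 'm vfield \<Rightarrow> 'm vfield" where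
  "lie_deriv11 V \<phi> X = lie_bracket V (\<phi> X) - \<phi> (lie_bracket V X)"

definition ext_deriv1 :: "('m vfield \<Rightarrow> 'm \<Rightarrow> real) \<Rightarrow> 'm vfield \<Rightarrow> 'm vfield \<Rightarrow> 'm \<Rightarrow> real" where
  "ext_deriv1 \<alpha> X Y = vf_app X (\<alpha> Y) - vf_app Y (\<alpha> X) - \<alpha> (lie_bracket X Y)"

definition ext_deriv2 ::
  "('m vfield \<Rightarrow> 'm vfield \<Rightarrow> 'm \<Rightarrow> real) \<Rightarrow> 'm vfield \<Rightarrow> 'm vfield \<Rightarrow> 'm vfield \<Rightarrow> 'm \<Rightarrow> real" where
  "ext_deriv2 \<omega> X Y Z =
     vf_app X (\<omega> Y Z) - vf_app Y (\<omega> X Z) + vf_app Z (\<omega> X Y)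
     - \<omega> (lie_bracket X Y) Z + \<omega> (lie_bracket X Z) Y - \<omega> (lie_bracket Y Z) X"


section \<open>Riemannian metrics, Levi-Civita connection, curvature\<close>

definition riemannian_metric ::
  "('m, 'e::euclidean_space) atlas_space \<Rightarrow> ('m vfield \<Rightarrow> 'm vfield \<Rightarrow> 'm \<Rightarrow> real) \<Rightarrow> bool" where
  "riemannian_metric M g \<longleftrightarrow>
     tensor02 M g \<and>
     (\<forall>X\<in>vector_fields M. \<forall>Y\<in>vector_fields M. \<forall>p\<in>pts M. g X Y p = g Y X p) \<and>
     (\<forall>X\<in>vector_fields M. \<forall>p\<in>pts M. X p \<noteq> 0 \<longrightarrow> g X X p > 0)"

definition affine_connection ::
  "('m, 'e::euclidean_space) atlas_space \<Rightarrow> ('m vfield \<Rightarrow> 'm vfield \<Rightarrow> 'm vfield) \<Rightarrow> bool" where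
  "affine_connection M D \<longleftrightarrow>
     (\<forall>Y\<in>vector_fields M. tensor11 M (\<lambda>X. D X Y)) \<and>
     (\<forall>X\<in>vector_fields M. \<forall>Y\<in>vector_fields M. \<forall>Z\<in>vector_fields M. D X (Y + Z) = D X Y + D X Z) \<and>
     (\<forall>X\<in>vector_fields M. \<forall>Y\<in>vector_fields M. \<forall>a\<in>smooth_functions M.
        D X (a *\<^sub>v Y) = vf_app X a *\<^sub>v Y + a *\<^sub>v D X Y)"

definition levi_civita ::
  "('m, 'e::euclidean_space) atlas_space \<Rightarrow> ('m vfield \<Rightarrow> 'm vfield \<Rightarrow> 'm \<Rightarrow> real) \<Rightarrow>
   ('m vfield \<Rightarrow> 'm vfield \<Rightarrow> 'm vfield) \<Rightarrow> bool" where
  "levi_civita M g D \<longleftrightarrow>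
     affine_connection M D \<and>
     (\<forall>X\<in>vector_fields M. \<forall>Y\<in>vector_fields M. D X Y - D Y X = lie_bracket X Y) \<and>
     (\<forall>X\<in>vector_fields M. \<forall>Y\<in>vector_fields M. \<forall>Z\<in>vector_fields M. \<forall>p\<in>pts M.
        vf_app X (g Y Z) p = g (D X Y) Z p + g Y (D X Z) p)"

definition curvature ::
  "('m vfield \<Rightarrow> 'm vfield \<Rightarrow> 'm vfield) \<Rightarrow> 'm vfield \<Rightarrow> 'm vfield \<Rightarrow> 'm vfield \<Rightarrow> 'm vfield" where
  "curvature D X Y Z = D X (D Y Z) - D Y (D X Z) - D (lie_bracket X Y) Z"

text \<open>The Levi-Civita connection is unique on vector fields.\<close>

lemma Ck_on_cong:
  assumes "open S" "\<And>x. x \<in> S \<Longrightarrow> f x = g x" "Ck_on k S f"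
  shows "Ck_on k S g"
  using assms(2,3)
proof (induction k arbitrary: f g)
  case 0
  then show ?case by (simp cong: continuous_on_cong)
next
  case (Suc k)
  have d: "f differentiable (at x)" if "x \<in> S" for x
    using Suc.prems that by auto
  have eq: "frechet_derivative f (at x) = frechet_derivative g (at x)" if "x \<in> S" for x
    using frechet_derivative_transform_within_open[OF d[OF that] assms(1) that] Suc.prems(1) by auto
  have "g differentiable (at x)" if "x \<in> S" for x
    by (metis (no_types, lifting) Suc.prems(1) assms(1) d differentiable_def
        has_derivative_transform_within_open that)
  moreover have "Ck_on k S (\<lambda>x. frechet_derivative g (at x) v)" for v
    by (rule Suc.IH[of "\<lambda>x. frechet_derivative f (at x) v"]) (use eq Suc.prems in auto)
  ultimately show ?case by simp
qed

lemma Ck_on_diff: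
  assumes "open S" "Ck_on k S f" "Ck_on k S g"
  shows "Ck_on k S (\<lambda>x. f x - g x)"
  using assms(2,3)
proof (induction k arbitrary: f g)
  case 0
  then show ?case by (simp add: continuous_on_diff)
next
  case (Suc k)
  have eq: "frechet_derivative (\<lambda>x. f x - g x) (at x) v
      = frechet_derivative f (at x) v - frechet_derivative g (at x) v" if "x \<in> S" for x v
  proof -
    have "((\<lambda>x. f x - g x) has_derivative
        (\<lambda>v. frechet_derivative f (at x) v - frechet_derivative g (at x) v)) (at x)"
      using Suc.prems that by (intro has_derivative_diff) (auto simp: frechet_derivative_works)
    then show ?thesis by (metis frechet_derivative_at)
  qed
  have "Ck_on k S (\<lambda>x. frechet_derivative (\<lambda>x. f x - g x) (at x) v)" for v
    by (rule Ck_on_cong[OF assms(1) _ Suc.IH[of "\<lambda>x. frechet_derivative f (at x) v"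
            "\<lambda>x. frechet_derivative g (at x) v"]]) (use eq Suc.prems in auto)
  then show ?case using Suc.prems by (auto intro: differentiable_diff)
qed

lemma smooth_functions_diff:
  assumes "smooth_manifold M" "f \<in> smooth_functions M" "g \<in> smooth_functions M"
  shows "(\<lambda>p. f p - g p) \<in> smooth_functions M"
proof -
  have "Ck_on k (c ` U) ((\<lambda>p. f p - g p) \<circ> inv_into U c)" if "(U, c) \<in> charts M" for U c k
  proof -
    have "open (c ` U)"
      using assms(1) that unfolding smooth_manifold_def by blast
    moreover have "Ck_on k (c ` U) (f \<circ> inv_into U c)" "Ck_on k (c ` U) (g \<circ> inv_into U c)"
      using assms(2,3) that unfolding smooth_functions_def smooth_on_def by blast+
    ultimately have "Ck_on k (c ` U) (\<lambda>x. (f \<circ> inv_into U c) x - (g \<circ> inv_into U c) x)"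
      by (rule Ck_on_diff)
    then show ?thesis by (simp add: o_def)
  qed
  then show ?thesis unfolding smooth_functions_def smooth_on_def by blast
qed

lemma tangent_space_diff:
  assumes v: "v \<in> tangent_space M p" and w: "w \<in> tangent_space M p"
  shows "v - w \<in> tangent_space M p"
proof -
  have "(v - w) f = 0" if "f \<notin> smooth_functions M" for f
    using that v w by (simp add: tangent_space_def)
  moreover have "(v - w) (\<lambda>q. a * f q + b * g q) = a * (v - w) f + b * (v - w) g"
    if "f \<in> smooth_functions M" "g \<in> smooth_functions M" for f g a b
  proof -
    have "v (\<lambda>q. a * f q + b * g q) = a * v f + b * v g"
      "w (\<lambda>q. a * f q + b * g q) = a * w f + b * w g"
      using that v w unfolding tangent_space_def by blast+
    then show ?thesis by (simp add: algebra_simps)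
  qed
  moreover have "(v - w) (\<lambda>q. f q * g q) = (v - w) f * g p + f p * (v - w) g"
    if "f \<in> smooth_functions M" "g \<in> smooth_functions M" for f g
  proof -
    have "v (\<lambda>q. f q * g q) = v f * g p + f p * v g" "w (\<lambda>q. f q * g q) = w f * g p + f p * w g"
      using that v w unfolding tangent_space_def by blast+
    then show ?thesis by (simp add: algebra_simps)
  qed
  ultimately show ?thesis unfolding tangent_space_def by blast
qed

lemma vector_fields_diff:
  assumes "smooth_manifold M" "X \<in> vector_fields M" "Y \<in> vector_fields M"
  shows "X - Y \<in> vector_fields M"
proof -
  have "(X - Y) p \<in> tangent_space M p" if "p \<in> pts M" for p
    using that assms(2,3) tangent_space_diff[of "X p" M p "Y p"] by (simp add: vector_fields_def)
  moreover have "(X - Y) p = 0" if "p \<notin> pts M" for p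
    using that assms(2,3) by (simp add: vector_fields_def)
  moreover have "(\<lambda>p. (X - Y) p f) \<in> smooth_functions M" if "f \<in> smooth_functions M" for f
    using that assms(2,3) smooth_functions_diff[OF assms(1), of "\<lambda>p. X p f" "\<lambda>p. Y p f"]
    by (simp add: vector_fields_def)
  ultimately show ?thesis by (simp add: vector_fields_def)
qed

lemma one_form_diff:
  assumes "smooth_manifold M" "one_form M \<alpha>" "X \<in> vector_fields M" "Y \<in> vector_fields M" "p \<in> pts M"
  shows "\<alpha> (X - Y) p = \<alpha> X p - \<alpha> Y p"
proof -
  have "\<alpha> ((X - Y) + Y) p = \<alpha> (X - Y) p + \<alpha> Y p"
    using assms vector_fields_diff unfolding one_form_def by blast
  then show ?thesis by simp
qed

lemma diff_swap: "(a::'a::ab_group_add) - b = c - d \<Longrightarrow> a - c = b - d"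
  by (simp add: algebra_simps)

lemma levi_civita_unique:
  assumes M: "smooth_manifold M" and g: "riemannian_metric M g"
    and D: "levi_civita M g D" and E: "levi_civita M g E"
    and X: "X \<in> vector_fields M" and Y: "Y \<in> vector_fields M"
  shows "D X Y = E X Y"
proof -
  define A where "A = (\<lambda>X Y. D X Y - E X Y)"
  have vf: "F X Y \<in> vector_fields M"
    if "levi_civita M g F" "X \<in> vector_fields M" "Y \<in> vector_fields M" for F X Y
  proof -
    have "affine_connection M F"
      using that(1) unfolding levi_civita_def by (rule conjunct1)
    then have "tensor11 M (\<lambda>X. F X Y)"
      using that(3) by (simp add: affine_connection_def)
    then show ?thesis using that(2) by (simp add: tensor11_def)
  qed
  note Dvf = vf[OF D] and Evf = vf[OF E]
  have Avf: "A X Y \<in> vector_fields M" if "X \<in> vector_fields M" "Y \<in> vector_fields M" for X Y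
    unfolding A_def by (rule vector_fields_diff[OF M Dvf[OF that] Evf[OF that]])
  have Asym: "A X Y = A Y X" if "X \<in> vector_fields M" "Y \<in> vector_fields M" for X Y
  proof -
    have "D X Y - D Y X = E X Y - E Y X"
      using D[unfolded levi_civita_def, THEN conjunct2, THEN conjunct1, rule_format, OF that]
        E[unfolded levi_civita_def, THEN conjunct2, THEN conjunct1, rule_format, OF that]
      by (rule trans[OF _ sym])
    then show ?thesis unfolding A_def by (rule diff_swap)
  qed
  have g2: "one_form M (g X)" "one_form M (\<lambda>Y. g Y X)" if "X \<in> vector_fields M" for X
    using g that by (simp_all add: riemannian_metric_def tensor02_def)
  have gsym: "g X Y p = g Y X p"
    if "X \<in> vector_fields M" "Y \<in> vector_fields M" "p \<in> pts M" for X Y p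
    using g[unfolded riemannian_metric_def, THEN conjunct2, THEN conjunct1, rule_format, OF that] .
  have Askew: "g (A X Y) Z p = - g (A X Z) Y p"
    if "X \<in> vector_fields M" "Y \<in> vector_fields M" "Z \<in> vector_fields M" "p \<in> pts M" for X Y Z p
  proof -
    have "g (D X Y) Z p + g Y (D X Z) p = g (E X Y) Z p + g Y (E X Z) p"
      using D[unfolded levi_civita_def, THEN conjunct2, THEN conjunct2, rule_format, OF that]
        E[unfolded levi_civita_def, THEN conjunct2, THEN conjunct2, rule_format, OF that]
      by (rule trans[OF sym])
    moreover have "g (A X Y) Z p = g (D X Y) Z p - g (E X Y) Z p"
      unfolding A_def by (rule one_form_diff[OF M g2(2)[OF that(3)] Dvf[OF that(1,2)] Evf[OF that(1,2)] that(4)])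
    moreover have "g Y (A X Z) p = g Y (D X Z) p - g Y (E X Z) p"
      unfolding A_def by (rule one_form_diff[OF M g2(1)[OF that(2)] Dvf[OF that(1,3)] Evf[OF that(1,3)] that(4)])
    moreover have "g Y (A X Z) p = g (A X Z) Y p"
      by (rule gsym[OF that(2) Avf[OF that(1,3)] that(4)])
    ultimately show ?thesis by linarith
  qed
  have zero: "g (A X Y) Z p = 0" if "Z \<in> vector_fields M" "p \<in> pts M" for Z p
    using Askew[OF X Y that] Askew[OF that(1) X Y that(2)] Askew[OF Y that(1) X that(2)]
    unfolding Asym[OF Y X] Asym[OF that(1) X] Asym[OF that(1) Y] by linarith
  have "A X Y p = 0" for p
  proof (cases "p \<in> pts M")
    case True
    then show ?thesis
      using zero[OF Avf[OF X Y] True]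
        g[unfolded riemannian_metric_def, THEN conjunct2, THEN conjunct2, rule_format, OF Avf[OF X Y] True]
      by linarith
  next
    case False
    then show ?thesis using Avf[OF X Y] by (simp add: vector_fields_def)
  qed
  then have "A X Y p = 0 p" for p by (simp only: zero_fun_apply)
  then have "A X Y = 0" by (rule ext)
  then show ?thesis unfolding A_def by (simp only: right_minus_eq)
qed


section \<open>Mixed Killing vector fields\<close>

definition mixed_killing ::
  "('m, 'e::euclidean_space) atlas_space \<Rightarrow> ('m vfield \<Rightarrow> 'm vfield \<Rightarrow> 'm \<Rightarrow> real) \<Rightarrow> 'm vfield \<Rightarrow> bool" where
  "mixed_killing M g V \<longleftrightarrow>
     V \<in> vector_fields M \<and>
     (\<exists>f\<in>smooth_functions M. (\<exists>p\<in>pts M. f p \<noteq> 0) \<and>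
        (\<forall>X\<in>vector_fields M. \<forall>Y\<in>vector_fields M. \<forall>p\<in>pts M.
           lie_deriv02 V (lie_deriv02 V g) X Y p = f p * lie_deriv02 V g X Y p))"


section \<open>Almost contact metric and almost coKaehler manifolds\<close>

definition almost_contact_metric ::
  "nat \<Rightarrow> ('m, 'e::euclidean_space) atlas_space \<Rightarrow> ('m vfield \<Rightarrow> 'm vfield) \<Rightarrow> 'm vfield \<Rightarrow>
   ('m vfield \<Rightarrow> 'm \<Rightarrow> real) \<Rightarrow> ('m vfield \<Rightarrow> 'm vfield \<Rightarrow> 'm \<Rightarrow> real) \<Rightarrow> bool" where
  "almost_contact_metric n M \<phi> \<xi> \<eta> g \<longleftrightarrow>
     n \<ge> 1 \<and> DIM('e) = 2 * n + 1 \<and> smooth_manifold M \<and> riemannian_metric M g \<and>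
     \<xi> \<in> vector_fields M \<and> one_form M \<eta> \<and> tensor11 M \<phi> \<and>
     (\<forall>Y\<in>vector_fields M. \<phi> (\<phi> Y) = - Y + \<eta> Y *\<^sub>v \<xi>) \<and>
     (\<forall>p\<in>pts M. \<eta> \<xi> p = 1) \<and>
     (\<forall>X\<in>vector_fields M. \<forall>Y\<in>vector_fields M. \<forall>p\<in>pts M.
        g (\<phi> X) (\<phi> Y) p = g X Y p - \<eta> X p * \<eta> Y p)"

definition fundamental_form ::
  "('m vfield \<Rightarrow> 'm vfield) \<Rightarrow> ('m vfield \<Rightarrow> 'm vfield \<Rightarrow> 'm \<Rightarrow> real) \<Rightarrow>
   'm vfield \<Rightarrow> 'm vfield \<Rightarrow> 'm \<Rightarrow> real" where
  "fundamental_form \<phi> g X Y = g X (\<phi> Y)"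

definition almost_cokaehler ::
  "nat \<Rightarrow> ('m, 'e::euclidean_space) atlas_space \<Rightarrow> ('m vfield \<Rightarrow> 'm vfield) \<Rightarrow> 'm vfield \<Rightarrow>
   ('m vfield \<Rightarrow> 'm \<Rightarrow> real) \<Rightarrow> ('m vfield \<Rightarrow> 'm vfield \<Rightarrow> 'm \<Rightarrow> real) \<Rightarrow> bool" where
  "almost_cokaehler n M \<phi> \<xi> \<eta> g \<longleftrightarrow>
     almost_contact_metric n M \<phi> \<xi> \<eta> g \<and>
     (\<forall>X\<in>vector_fields M. \<forall>Y\<in>vector_fields M. \<forall>p\<in>pts M. ext_deriv1 \<eta> X Y p = 0) \<and>
     (\<forall>X\<in>vector_fields M. \<forall>Y\<in>vector_fields M. \<forall>Z\<in>vector_fields M. \<forall>p\<in>pts M.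
        ext_deriv2 (fundamental_form \<phi> g) X Y Z p = 0)"

definition h_tensor :: "('m vfield \<Rightarrow> 'm vfield) \<Rightarrow> 'm vfield \<Rightarrow> 'm vfield \<Rightarrow> 'm vfield" where
  "h_tensor \<phi> \<xi> X = (\<lambda>_. 1 / 2) *\<^sub>v lie_deriv11 \<xi> \<phi> X"

definition kappa_mu_almost_cokaehler ::
  "nat \<Rightarrow> ('m, 'e::euclidean_space) atlas_space \<Rightarrow> ('m vfield \<Rightarrow> 'm vfield) \<Rightarrow> 'm vfield \<Rightarrow>
   ('m vfield \<Rightarrow> 'm \<Rightarrow> real) \<Rightarrow> ('m vfield \<Rightarrow> 'm vfield \<Rightarrow> 'm \<Rightarrow> real) \<Rightarrow>
   ('m \<Rightarrow> real) \<Rightarrow> ('m \<Rightarrow> real) \<Rightarrow> bool" where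
  "kappa_mu_almost_cokaehler n M \<phi> \<xi> \<eta> g \<kappa> \<mu> \<longleftrightarrow>
     almost_cokaehler n M \<phi> \<xi> \<eta> g \<and>
     \<kappa> \<in> smooth_functions M \<and> \<mu> \<in> smooth_functions M \<and>
     (\<exists>D. levi_civita M g D \<and>
        (\<forall>X\<in>vector_fields M. \<forall>Y\<in>vector_fields M.
           curvature D X Y \<xi> =
             \<kappa> *\<^sub>v (\<eta> Y *\<^sub>v X - \<eta> X *\<^sub>v Y) +
             \<mu> *\<^sub>v (\<eta> Y *\<^sub>v h_tensor \<phi> \<xi> X - \<eta> X *\<^sub>v h_tensor \<phi> \<xi> Y)))"

definition non_cokaehler_kappa_mu ::
  "nat \<Rightarrow> ('m, 'e::euclidean_space) atlas_space \<Rightarrow> ('m vfield \<Rightarrow> 'm vfield) \<Rightarrow> 'm vfield \<Rightarrow>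
   ('m vfield \<Rightarrow> 'm \<Rightarrow> real) \<Rightarrow> ('m vfield \<Rightarrow> 'm vfield \<Rightarrow> 'm \<Rightarrow> real) \<Rightarrow>
   ('m \<Rightarrow> real) \<Rightarrow> ('m \<Rightarrow> real) \<Rightarrow> bool" where
  "non_cokaehler_kappa_mu n M \<phi> \<xi> \<eta> g \<kappa> \<mu> \<longleftrightarrow>
     kappa_mu_almost_cokaehler n M \<phi> \<xi> \<eta> g \<kappa> \<mu> \<and> (\<forall>p\<in>pts M. \<kappa> p < 0)"

end

theory Submission
  imports Defs
begin

text \<open>
  Put \<open>S X = \<nabla>\<^sub>X \<xi>\<close>. From \<open>d\<eta> = 0\<close> the field \<open>S\<close> is self-adjoint and kills \<open>\<xi>\<close>; \<open>L\<^sub>\<xi> (\<phi>\<^sup>2)\<close> being a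
  multiple of \<open>\<xi>\<close> makes \<open>h\<close> anticommute with \<open>\<phi>\<close> modulo \<open>\<xi>\<close>, and \<open>d\<Phi> = 0\<close> gives \<open>h = - S\<phi>\<close>, so \<open>S\<close>
  anticommutes with \<open>\<phi>\<close> as well. If \<open>\<xi>\<close> is mixed Killing with factor \<open>f\<close>, then eliminating \<open>\<nabla>\<^sub>\<xi> S\<close>
  between \<open>L\<^sub>\<xi> L\<^sub>\<xi> g = f L\<^sub>\<xi> g\<close> and the formula for \<open>R(X, \<xi>)\<xi>\<close> yields, for \<open>X\<close> orthogonal to \<open>\<xi>\<close>,
  \<open>g(SX, SX) - \<kappa> g(X, X) = \<mu> g(hX, X) + f g(SX, X)\<close>.
  Adding the same identity for \<open>\<phi>X\<close> cancels the right-hand side and leaves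
  \<open>g(SX, SX) + g(S\<phi>X, S\<phi>X) = 2 \<kappa> g(X, X)\<close>, which is impossible for \<open>\<kappa> < 0\<close> if \<open>X \<noteq> 0\<close>. Such an \<open>X\<close>
  exists because the dimension is at least \<open>3\<close>: cut off coordinate fields by a bump function.
\<close>

section \<open>Calculus of smooth maps\<close>

lemma Ck_on_Suc_imp: "Ck_on (Suc k) S f \<Longrightarrow> Ck_on k S f"
proof (induction k arbitrary: f)
  case 0
  then show ?case
    by (auto intro!: continuous_at_imp_continuous_on differentiable_imp_continuous_within)
next
  case (Suc k)
  then show ?case by (metis Ck_on.simps(2))
qed

lemma Ck_on_subset: "Ck_on k S f \<Longrightarrow> T \<subseteq> S \<Longrightarrow> Ck_on k T f"
  by (induction k arbitrary: f) (auto intro: continuous_on_subset)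

text \<open>\<open>frechet_derivative f (at x)\<close> makes no mention of the set, so the local
  pieces need no compatibility condition and the induction passes directly to the
  derivatives.\<close>

lemma Ck_on_locally:
  assumes "\<And>x. x \<in> S \<Longrightarrow> \<exists>T. open T \<and> x \<in> T \<and> Ck_on k T f"
  shows "Ck_on k S f"
  using assms
proof (induction k arbitrary: f)
  case 0
  then show ?case
    by (force intro!: continuous_at_imp_continuous_on simp: continuous_on_eq_continuous_at)
next
  case (Suc k)
  have "f differentiable (at x)" if "x \<in> S" for x
    using Suc.prems[OF that] by auto
  moreover have "Ck_on k S (\<lambda>x. frechet_derivative f (at x) v)" for v
    by (rule Suc.IH) (use Suc.prems in \<open>fastforce\<close>)
  ultimately show ?case by simp
qed

lemma Ck_on_const: "Ck_on k S (\<lambda>x. a)"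
  by (induction k arbitrary: a) (auto simp: frechet_derivative_const)

lemma Ck_on_add:
  assumes "open S" "Ck_on k S f" "Ck_on k S g"
  shows "Ck_on k S (\<lambda>x. f x + g x)"
  using Ck_on_diff[OF assms(1,2) Ck_on_diff[OF assms(1) Ck_on_const[of k S 0] assms(3)]] by simp

lemma Ck_on_bounded_linear:
  assumes L: "bounded_linear L" and S: "open S" and f: "Ck_on k S f"
  shows "Ck_on k S (\<lambda>x. L (f x))"
  using f
proof (induction k arbitrary: f)
  case 0
  then show ?case
    using continuous_on_compose[of S f L] L
    by (simp add: o_def linear_continuous_on)
next
  case (Suc k)
  have d: "((\<lambda>x. L (f x)) has_derivative (\<lambda>v. L (frechet_derivative f (at x) v))) (at x)"
    if "x \<in> S" for x
    using Suc.prems that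
    by (intro bounded_linear.has_derivative[OF L]) (auto simp: frechet_derivative_works)
  have "Ck_on k S (\<lambda>x. frechet_derivative (\<lambda>x. L (f x)) (at x) v)" for v
    by (rule Ck_on_cong[OF S _ Suc.IH[of "\<lambda>x. frechet_derivative f (at x) v"]])
      (use Suc.prems in \<open>auto simp: frechet_derivative_at[OF d, symmetric]\<close>)
  then show ?case using d by (auto simp: differentiable_def)
qed

lemma Ck_on_scaleR:
  assumes S: "open S" and "Ck_on k S f" "Ck_on k S g"
  shows "Ck_on k S (\<lambda>x. f x *\<^sub>R g x)"
  using assms(2,3)
proof (induction k arbitrary: f g)
  case 0
  then show ?case by (simp add: continuous_on_scaleR)
next
  case (Suc k)
  let ?D = "\<lambda>f x. frechet_derivative f (at x)"
  have d: "((\<lambda>x. f x *\<^sub>R g x) has_derivative (\<lambda>v. f x *\<^sub>R ?D g x v + ?D f x v *\<^sub>R g x)) (at x)"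
    if "x \<in> S" for x
    using Suc.prems that
    by (intro has_derivative_scaleR) (auto simp: frechet_derivative_works)
  \<comment> \<open>The product rule keeps one factor undifferentiated, so the induction hypothesis
    is also fed \<open>f\<close> and \<open>g\<close> themselves, lowered to order \<open>k\<close>
    by \<open>Ck_on_Suc_imp\<close>.\<close>
  have "Ck_on k S (\<lambda>x. f x *\<^sub>R ?D g x v + ?D f x v *\<^sub>R g x)" for v
    using Suc.prems Ck_on_Suc_imp[OF Suc.prems(1)] Ck_on_Suc_imp[OF Suc.prems(2)]
    by (intro Ck_on_add S Suc.IH) auto
  then have "Ck_on k S (\<lambda>x. ?D (\<lambda>x. f x *\<^sub>R g x) x v)" for v
    by (rule Ck_on_cong[OF S, rotated]) (simp only: frechet_derivative_at[OF d, symmetric])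
  then show ?case using d by (auto simp: differentiable_def)
qed

lemma Ck_on_mult:
  fixes f g :: "'a::real_normed_vector \<Rightarrow> real"
  assumes "open S" "Ck_on k S f" "Ck_on k S g"
  shows "Ck_on k S (\<lambda>x. f x * g x)"
  using Ck_on_scaleR[OF assms] by simp

lemma Ck_on_sum:
  assumes "open S" "\<And>i. i \<in> I \<Longrightarrow> Ck_on k S (f i)"
  shows "Ck_on k S (\<lambda>x. \<Sum>i\<in>I. f i x)"
  using assms(2)
  by (induction I rule: infinite_finite_induct) (auto intro: Ck_on_const Ck_on_add[OF assms(1)])

lemma Ck_on_inner_const: "open S \<Longrightarrow> Ck_on k S f \<Longrightarrow> Ck_on k S (\<lambda>x. f x \<bullet> i)"
  by (rule Ck_on_bounded_linear[OF bounded_linear_inner_left])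

lemma Ck_on_ident: "open S \<Longrightarrow> Ck_on k S (\<lambda>x. x)"
  by (cases k) (auto intro: continuous_on_id simp: Ck_on_const frechet_derivative_ident)

text \<open>The chain rule differentiates \<open>g\<close> in a direction that moves with
  \<open>x\<close>, whereas \<open>Ck_on\<close> speaks of fixed directions. Expanding that
  direction in \<open>Basis\<close> of the intermediate space reduces the derivative to sums of
  products to which the induction hypothesis applies.\<close>

lemma Ck_on_compose:
  fixes f :: "'a::real_normed_vector \<Rightarrow> 'b::euclidean_space"
  assumes S: "open S" and "Ck_on k T g" "Ck_on k S f" "f ` S \<subseteq> T"
  shows "Ck_on k S (\<lambda>x. g (f x))"
  using assms(2,3)
proof (induction k arbitrary: g)
  case 0
  then show ?case
    using continuous_on_compose2[of T g S f] assms(4) by simp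
next
  case (Suc k)
  let ?D = "\<lambda>f x. frechet_derivative f (at x)"
  have d: "((\<lambda>x. g (f x)) has_derivative (\<lambda>v. ?D g (f x) (?D f x v))) (at x)"
    if "x \<in> S" for x
    using Suc.prems that assms(4)
    by (intro has_derivative_compose[of f "?D f x" x UNIV g "?D g (f x)"])
      (auto simp: frechet_derivative_works)
  have eq: "?D g (f x) (?D f x v) = (\<Sum>i\<in>Basis. (?D f x v \<bullet> i) *\<^sub>R ?D g (f x) i)"
    if "x \<in> S" for x v
  proof -
    have "linear (?D g (f x))"
      using Suc.prems that assms(4) by (auto intro!: linear_frechet_derivative)
    then have "?D g (f x) (\<Sum>i\<in>Basis. (?D f x v \<bullet> i) *\<^sub>R i)
        = (\<Sum>i\<in>Basis. (?D f x v \<bullet> i) *\<^sub>R ?D g (f x) i)"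
      by (simp add: linear_sum linear_scale)
    then show ?thesis by (simp only: euclidean_representation)
  qed
  have "Ck_on k S (\<lambda>x. \<Sum>i\<in>Basis. (?D f x v \<bullet> i) *\<^sub>R ?D g (f x) i)" for v
    using Suc.prems Ck_on_Suc_imp[OF Suc.prems(2)]
    by (intro Ck_on_sum Ck_on_scaleR Ck_on_inner_const S Suc.IH[of "\<lambda>x. ?D g x _"]) auto
  then have "Ck_on k S (\<lambda>x. ?D (\<lambda>x. g (f x)) x v)" for v
    by (rule Ck_on_cong[OF S, rotated])
      (simp only: frechet_derivative_at[OF d, symmetric] eq)
  then show ?case using d by (auto simp: differentiable_def)
qed

section \<open>Bump functions\<close>

text \<open>The classical flat function exp(-1/t), extended by zero, is the case
  \<open>n = 0\<close>. The further powers of 1/t make the linear span of the family closed under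
  differentiation.\<close>

definition flat :: "nat \<Rightarrow> real \<Rightarrow> real" where
  "flat n t = (if t > 0 then inverse t ^ n * exp (- inverse t) else 0)"

text \<open>On the right, substituting s = 1/t leaves s^n / exp s as s tends to infinity.\<close>

lemma flat_tendsto_0: "(flat n \<longlongrightarrow> 0) (at 0)"
proof (rule filterlim_split_at)
  show "(flat n \<longlongrightarrow> 0) (at_left 0)"
    by (rule tendsto_eventually) (auto simp: flat_def eventually_at_filter)
  have "((\<lambda>t. inverse t ^ n / exp (inverse t)) \<longlongrightarrow> 0) (at_right (0::real))"
    by (rule filterlim_compose[OF tendsto_power_div_exp_0 filterlim_inverse_at_top_right])
  then show "(flat n \<longlongrightarrow> 0) (at_right 0)"
    by (rule Lim_transform_eventually)
      (auto simp: flat_def eventually_at_filter exp_minus divide_inverse)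
qed

lemma flat_has_derivative:
  "(flat n has_real_derivative (flat (n + 2) t - n * flat (n + 1) t)) (at t)"
proof -
  consider "t > 0" | "t < 0" | "t = 0" by linarith
  then show ?thesis
  proof cases
    case 1
    have pow: "((\<lambda>t. inverse t ^ n) has_real_derivative - (n * inverse t ^ (n + 1))) (at t)"
    proof (induction n)
      case (Suc n)
      show ?case
        using DERIV_mult[OF DERIV_inverse[of t UNIV] Suc] 1
        by (simp add: algebra_simps)
    qed simp
    have exp: "((\<lambda>t. exp (- inverse t)) has_real_derivative
        exp (- inverse t) * inverse t ^ 2) (at t)"
      using 1 by (auto intro!: derivative_eq_intros simp: power2_eq_square)
    have "- (n * inverse t ^ (n + 1)) * exp (- inverse t)
        + exp (- inverse t) * inverse t ^ 2 * inverse t ^ n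
        = flat (n + 2) t - n * flat (n + 1) t"
      using 1 by (simp add: flat_def algebra_simps power2_eq_square)
    then have "((\<lambda>t. inverse t ^ n * exp (- inverse t)) has_real_derivative
        (flat (n + 2) t - n * flat (n + 1) t)) (at t)"
      using DERIV_mult[OF pow exp] by (simp only:)
    then show ?thesis
      by (rule has_field_derivative_transform_within_open[of _ _ _ "{0<..}"])
        (use 1 in \<open>auto simp: flat_def\<close>)
  next
    case 2
    have "((\<lambda>t. 0) has_real_derivative (flat (n + 2) t - n * flat (n + 1) t)) (at t)"
      using 2 by (simp add: flat_def)
    then show ?thesis
      by (rule has_field_derivative_transform_within_open[of _ _ _ "{..<0}"])
        (use 2 in \<open>auto simp: flat_def\<close>)
  next
    case 3
    \<comment> \<open>At 0 the difference quotient is itself the next member of the family; at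
      \<open>h = 0\<close> both sides are 0, the left one by the convention on division.\<close>
    have "(flat n (0 + h) - flat n 0) / h = flat (n + 1) h" for h
      by (simp add: flat_def field_simps)
    moreover have "flat (n + 2) 0 - n * flat (n + 1) 0 = 0"
      by (simp add: flat_def)
    ultimately show ?thesis
      unfolding 3 DERIV_def using flat_tendsto_0[of "n + 1"] by (simp only:)
  qed
qed

lemma Ck_on_flat: "Ck_on k UNIV (flat n)"
proof (induction k arbitrary: n)
  case 0
  show ?case
    by (auto intro!: continuous_at_imp_continuous_on DERIV_isCont[OF flat_has_derivative])
next
  case (Suc k)
  have d: "(flat n has_derivative (\<lambda>v. (flat (n + 2) t - n * flat (n + 1) t) * v)) (at t)" for t
    using flat_has_derivative[of n t] by (simp add: has_field_derivative_def)
  have "Ck_on k UNIV (\<lambda>t. (flat (n + 2) t - n * flat (n + 1) t) * v)" for v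
    by (intro Ck_on_mult Ck_on_diff Ck_on_const Suc.IH open_UNIV)
  then have "Ck_on k UNIV (\<lambda>t. frechet_derivative (flat n) (at t) v)" for v
    by (simp only: frechet_derivative_at[OF d, symmetric])
  then show ?case using d by (auto simp: differentiable_def)
qed

text \<open>The squared norm is used because the norm itself is not smooth at the centre.\<close>

definition bump :: "'e::euclidean_space \<Rightarrow> real \<Rightarrow> 'e \<Rightarrow> real" where
  "bump a r x = flat 0 (r\<^sup>2 - (norm (x - a))\<^sup>2)"

lemma Ck_on_bump: "Ck_on k UNIV (bump a r)"
proof -
  have "Ck_on k UNIV (\<lambda>x. \<Sum>i\<in>Basis. ((x - a) \<bullet> i) * ((x - a) \<bullet> i))"
    by (intro Ck_on_sum Ck_on_mult Ck_on_inner_const Ck_on_diff Ck_on_ident Ck_on_const open_UNIV)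
  then have "Ck_on k UNIV (\<lambda>x. r\<^sup>2 - (norm (x - a))\<^sup>2)"
    by (intro Ck_on_diff Ck_on_const open_UNIV)
      (simp only: power2_norm_eq_inner euclidean_inner[symmetric])
  then have "Ck_on k UNIV (\<lambda>x. flat 0 (r\<^sup>2 - (norm (x - a))\<^sup>2))"
    by (rule Ck_on_compose[OF open_UNIV Ck_on_flat]) simp
  then show ?thesis unfolding bump_def[abs_def] .
qed

lemma bump_centre: "r > 0 \<Longrightarrow> bump a r a > 0"
  by (simp add: bump_def flat_def)

lemma bump_outside:
  assumes "r > 0" "x \<notin> cball a r"
  shows "bump a r x = 0"
proof -
  have "r\<^sup>2 \<le> (norm (x - a))\<^sup>2"
    using assms by (intro power_mono) (auto simp: dist_norm norm_minus_commute)
  then show ?thesis by (simp add: bump_def flat_def)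
qed

section \<open>Vector fields on manifolds\<close>

lemma smooth_manifold_chart:
  assumes "smooth_manifold M" "(U, c) \<in> charts M"
  shows "openin (space_top M) U" "open (c ` U)" "U \<subseteq> pts M" "inj_on c U"
    "homeomorphic_map (subtopology (space_top M) U) (top_of_set (c ` U)) c"
proof -
  show U: "openin (space_top M) U" and "open (c ` U)"
    and h: "homeomorphic_map (subtopology (space_top M) U) (top_of_set (c ` U)) c"
    using assms unfolding smooth_manifold_def by blast+
  show sub: "U \<subseteq> pts M"
    using openin_subset[OF U] by (simp add: pts_def)
  show "inj_on c U"
    using homeomorphic_imp_injective_map[OF h] sub
    by (simp add: pts_def Int_absorb1)
qed

lemma chart_image_open:
  assumes M: "smooth_manifold M" "(U, c) \<in> charts M" and W: "openin (space_top M) W"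
  shows "open (c ` (U \<inter> W))"
proof -
  have "openin (subtopology (space_top M) U) (U \<inter> W)"
    by (rule openin_subtopology_Int2[OF W])
  then have "openin (top_of_set (c ` U)) (c ` (U \<inter> W))"
    using homeomorphic_imp_open_map[OF smooth_manifold_chart(5)[OF M]]
    by (simp add: open_map_def)
  then show ?thesis
    by (rule openin_open_trans[OF _ smooth_manifold_chart(2)[OF M]])
qed

text \<open>Compactness survives the inverse of the chart and the passage from \<open>U\<close> to
  the whole space, where the Hausdorff property turns it into closedness.\<close>

lemma closedin_chart_compact:
  assumes M: "smooth_manifold M" "(U, c) \<in> charts M" and K: "compact K" "K \<subseteq> c ` U"
  shows "closedin (space_top M) (inv_into U c ` K)"
proof -
  have 1: "inv_into U c ` K \<subseteq> U" "c ` inv_into U c ` K = K"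
    using K(2) image_inv_into_cancel[OF refl K(2)] by (auto intro: inv_into_into)
  have "compactin (top_of_set (c ` U)) (c ` inv_into U c ` K)"
    using K by (simp add: 1 compactin_subtopology)
  then have "compactin (subtopology (space_top M) U) (inv_into U c ` K)"
    using homeomorphic_map_compactness[OF smooth_manifold_chart(5)[OF M], of "inv_into U c ` K"]
      1(1) subset_trans[OF 1(1) smooth_manifold_chart(3)[OF M]] by (simp add: pts_def)
  then have "compactin (space_top M) (inv_into U c ` K)"
    by (simp add: compactin_subtopology)
  moreover have "Hausdorff_space (space_top M)"
    using M(1) by (simp add: smooth_manifold_def)
  ultimately show ?thesis by (intro compactin_imp_closedin)
qed

section \<open>The algebra of smooth functions, and extension by zero\<close>

lemma smooth_functionsI:
  "(\<And>U c k. (U, c) \<in> charts M \<Longrightarrow> Ck_on k (c ` U) (\<lambda>x. f (inv_into U c x))) \<Longrightarrow>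
    f \<in> smooth_functions M"
  by (auto simp: smooth_functions_def smooth_on_def o_def)

lemma smooth_functionsD:
  "f \<in> smooth_functions M \<Longrightarrow> (U, c) \<in> charts M \<Longrightarrow> Ck_on k (c ` U) (\<lambda>x. f (inv_into U c x))"
  by (auto simp: smooth_functions_def smooth_on_def o_def)

lemma smooth_functions_const: "(\<lambda>_. a) \<in> smooth_functions M"
  by (rule smooth_functionsI) (rule Ck_on_const)

lemma smooth_functions_add:
  assumes "smooth_manifold M" "f \<in> smooth_functions M" "g \<in> smooth_functions M"
  shows "(\<lambda>p. f p + g p) \<in> smooth_functions M"
  by (intro smooth_functionsI Ck_on_add smooth_manifold_chart(2)[OF assms(1)]
      smooth_functionsD[OF assms(2)] smooth_functionsD[OF assms(3)])

lemma smooth_functions_mult: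
  assumes "smooth_manifold M" "f \<in> smooth_functions M" "g \<in> smooth_functions M"
  shows "(\<lambda>p. f p * g p) \<in> smooth_functions M"
  by (intro smooth_functionsI Ck_on_mult smooth_manifold_chart(2)[OF assms(1)]
      smooth_functionsD[OF assms(2)] smooth_functionsD[OF assms(3)])

lemma smooth_functions_cong:
  assumes M: "smooth_manifold M" and f: "f \<in> smooth_functions M"
    and eq: "\<And>q. q \<in> pts M \<Longrightarrow> f q = f' q"
  shows "f' \<in> smooth_functions M"
proof (rule smooth_functionsI)
  fix U c k assume U: "(U, c) \<in> charts M"
  show "Ck_on k (c ` U) (\<lambda>x. f' (inv_into U c x))"
    by (rule Ck_on_cong[OF smooth_manifold_chart(2)[OF M U] _ smooth_functionsD[OF f U]])
      (rule eq, rule subsetD[OF smooth_manifold_chart(3)[OF M U]], rule inv_into_into)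
qed

text \<open>In another chart \<open>d\<close>, near points of \<open>U\<close> the function is
  \<open>u\<close> after a transition map; every other point has a neighbourhood on which it is 0.
  Smoothness is local, so the two cases suffice.\<close>

lemma chart_extension_smooth:
  assumes M: "smooth_manifold M" "(U, c) \<in> charts M" and K: "compact K" "K \<subseteq> c ` U"
    and u: "\<And>k. Ck_on k (c ` U) u" and zero: "\<And>x. x \<in> c ` U - K \<Longrightarrow> u x = 0"
  shows "(\<lambda>q. if q \<in> U then u (c q) else 0) \<in> smooth_functions M"
proof (rule smooth_functionsI, rule Ck_on_locally)
  fix V d k y
  assume V: "(V, d) \<in> charts M" and y: "y \<in> d ` V"
  let ?i = "inv_into V d"
  let ?w = "\<lambda>x. if ?i x \<in> U then u (c (?i x)) else 0"
  note U = smooth_manifold_chart[OF M]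
  note V' = smooth_manifold_chart[OF M(1) V]
  have iV: "?i x \<in> V" "d (?i x) = x" if "x \<in> d ` V" for x
    using that by (auto simp: inv_into_into f_inv_into_f)
  show "\<exists>T. open T \<and> y \<in> T \<and> Ck_on k T ?w"
  proof (cases "?i y \<in> U")
    case True
    let ?T = "d ` (V \<inter> U)"
    have T: "open ?T"
      by (rule chart_image_open[OF M(1) V U(1)])
    have "Ck_on k ?T (c \<circ> ?i)"
      using M V unfolding smooth_manifold_def smooth_on_def by blast
    moreover have im: "?i x \<in> U" if "x \<in> ?T" for x
      using that V'(4) by auto
    ultimately have "Ck_on k ?T (\<lambda>x. u ((c \<circ> ?i) x))"
      by (intro Ck_on_compose[OF T u]) (auto simp: o_def)
    then have "Ck_on k ?T ?w"
      by (rule Ck_on_cong[OF T, rotated]) (use im in auto)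
    moreover have "y \<in> ?T"
      using iV[OF y] True by (metis IntI imageI)
    ultimately show ?thesis using T by blast
  next
    case False
    \<comment> \<open>A neighbourhood of a boundary point of \<open>U\<close> still meets
      \<open>U\<close>, so the complement of \<open>U\<close> need not be open; the complement of
      the closed set \<open>?K\<close> is.\<close>
    let ?K = "inv_into U c ` K"
    let ?T = "d ` (V \<inter> (topspace (space_top M) - ?K))"
    have T: "open ?T"
      using closedin_chart_compact[OF M K]
      by (intro chart_image_open[OF M(1) V]) (simp add: closedin_def)
    have "?w x = 0" if "x \<in> ?T" for x
    proof -
      have "?i x \<notin> ?K"
        using that V'(4) by auto
      moreover have "?i x \<in> ?K" if "c (?i x) \<in> K" "?i x \<in> U"
        using that U(4) by (metis image_eqI inv_into_f_f)
      ultimately show ?thesis using zero by auto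
    qed
    then have "Ck_on k ?T ?w"
      by (intro Ck_on_cong[OF T _ Ck_on_const[of k _ 0]]) auto
    moreover have "?i y \<notin> ?K"
      using False K(2) by (auto simp: inv_into_into)
    then have "y \<in> ?T"
      using iV[OF y] V'(3) by (metis DiffI IntI imageI pts_def subsetD)
    ultimately show ?thesis using T by blast
  qed
qed

section \<open>Tangent vectors as derivations\<close>

lemma tangent_space_lincomb:
  assumes "v \<in> tangent_space M p" "f \<in> smooth_functions M" "g \<in> smooth_functions M"
  shows "v (\<lambda>q. a * f q + b * g q) = a * v f + b * v g"
  using assms unfolding tangent_space_def by blast

lemma tangent_space_mult:
  assumes "v \<in> tangent_space M p" "f \<in> smooth_functions M" "g \<in> smooth_functions M"
  shows "v (\<lambda>q. f q * g q) = v f * g p + f p * v g"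
  using assms unfolding tangent_space_def by blast

text \<open>Multiplying by the indicator \<open>e\<close> of \<open>pts M\<close> erases the
  difference between \<open>f\<close> and \<open>f'\<close>, and the Leibniz rule for
  \<open>e * e = e\<close> forces \<open>v e = 0\<close>. If \<open>f\<close> is not smooth, neither
  is \<open>f'\<close>, and both values are the default 0.\<close>

lemma tangent_space_cong:
  assumes M: "smooth_manifold M" and v: "v \<in> tangent_space M p" and p: "p \<in> pts M"
    and eq: "\<And>q. q \<in> pts M \<Longrightarrow> f q = f' q"
  shows "v f = v f'"
proof (cases "f \<in> smooth_functions M")
  case f: True
  define e where "e q = (if q \<in> pts M then 1 else 0 :: real)" for q
  have e: "e \<in> smooth_functions M"
    by (rule smooth_functions_cong[OF M smooth_functions_const[of 1]]) (simp add: e_def)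
  have f': "f' \<in> smooth_functions M"
    by (rule smooth_functions_cong[OF M f eq])
  have "v (\<lambda>q. e q * e q) = v e * e p + e p * v e"
    by (rule tangent_space_mult[OF v e e])
  moreover have "(\<lambda>q. e q * e q) = e" "(\<lambda>q. f q * e q) = (\<lambda>q. f' q * e q)"
    using eq by (auto simp: e_def)
  ultimately show ?thesis
    using tangent_space_mult[OF v f e] tangent_space_mult[OF v f' e] p by (simp add: e_def)
next
  case False
  moreover have "f' \<notin> smooth_functions M"
    using False smooth_functions_cong[OF M, of f' f] eq by auto
  ultimately show ?thesis using v by (simp add: tangent_space_def)
qed

lemma tangent_space_const:
  assumes v: "v \<in> tangent_space M p"
  shows "v (\<lambda>_. a) = 0"
proof -
  have "v (\<lambda>_. 1 * 1) = v (\<lambda>_. 1) * 1 + 1 * v (\<lambda>_. 1)"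
    by (rule tangent_space_mult[OF v smooth_functions_const smooth_functions_const])
  moreover have "v (\<lambda>_. a * 1 + 0 * 1) = a * v (\<lambda>_. 1) + 0 * v (\<lambda>_. 1)"
    by (rule tangent_space_lincomb[OF v smooth_functions_const smooth_functions_const])
  ultimately show ?thesis by simp
qed

section \<open>The module of vector fields, and cut-off coordinate fields\<close>

lemma vector_fieldsD:
  assumes "X \<in> vector_fields M"
  shows "p \<in> pts M \<Longrightarrow> X p \<in> tangent_space M p" "p \<notin> pts M \<Longrightarrow> X p = 0"
    "f \<in> smooth_functions M \<Longrightarrow> vf_app X f \<in> smooth_functions M"
  using assms by (auto simp: vector_fields_def vf_app_def)

lemma vector_fields_0: "smooth_manifold M \<Longrightarrow> X \<in> vector_fields M \<Longrightarrow> 0 \<in> vector_fields M"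
  using vector_fields_diff[of M X X] by simp

lemma vector_fields_minus: "smooth_manifold M \<Longrightarrow> X \<in> vector_fields M \<Longrightarrow> - X \<in> vector_fields M"
  using vector_fields_diff[OF _ vector_fields_0, of M X X] by simp

lemma vector_fields_add:
  "smooth_manifold M \<Longrightarrow> X \<in> vector_fields M \<Longrightarrow> Y \<in> vector_fields M \<Longrightarrow> X + Y \<in> vector_fields M"
  using vector_fields_diff[OF _ _ vector_fields_minus, of M X Y] by simp

lemma vector_fields_scale:
  assumes M: "smooth_manifold M" and a: "a \<in> smooth_functions M" and X: "X \<in> vector_fields M"
  shows "a *\<^sub>v X \<in> vector_fields M"
proof -
  have "(a *\<^sub>v X) p \<in> tangent_space M p" if "p \<in> pts M" for p
    using vector_fieldsD(1)[OF X that]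
    by (simp add: tangent_space_def vf_scale_def algebra_simps)
  moreover have "(\<lambda>p. (a *\<^sub>v X) p f) \<in> smooth_functions M" if "f \<in> smooth_functions M" for f
    using smooth_functions_mult[OF M a vector_fieldsD(3)[OF X that]]
    by (simp add: vf_scale_def vf_app_def)
  moreover have "(a *\<^sub>v X) p = 0" if "p \<notin> pts M" for p
    using vector_fieldsD(2)[OF X that] by (simp add: vf_scale_def fun_eq_iff)
  ultimately show ?thesis by (simp add: vector_fields_def)
qed

text \<open>The directional derivative along \<open>v\<close> read in the chart, cut off by
  \<open>b\<close> and extended by zero. The value 0 on non-smooth functions is the convention of
  \<open>tangent_space\<close>.\<close>

definition chart_field ::
  "('m, 'e::euclidean_space) atlas_space \<Rightarrow> 'm set \<Rightarrow> ('m \<Rightarrow> 'e) \<Rightarrow> ('e \<Rightarrow> real) \<Rightarrow> 'e \<Rightarrow> 'm vfield"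
where
  "chart_field M U c b v = (\<lambda>q f.
     if q \<in> U \<and> f \<in> smooth_functions M
     then b (c q) * frechet_derivative (\<lambda>x. f (inv_into U c x)) (at (c q)) v else 0)"

lemma chart_derivative:
  assumes "(U, c) \<in> charts M" "q \<in> U" "f \<in> smooth_functions M"
  shows "((\<lambda>x. f (inv_into U c x)) has_derivative
    frechet_derivative (\<lambda>x. f (inv_into U c x)) (at (c q))) (at (c q))"
  using smooth_functionsD[OF assms(3,1), of "Suc 0"] assms(2)
  by (simp add: frechet_derivative_works)

lemma chart_field_linear:
  assumes "(U, c) \<in> charts M"
  shows "chart_field M U c b (s *\<^sub>R v + t *\<^sub>R w) q f
    = s * chart_field M U c b v q f + t * chart_field M U c b w q f"
proof (cases "q \<in> U \<and> f \<in> smooth_functions M")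
  case True
  then have "linear (frechet_derivative (\<lambda>x. f (inv_into U c x)) (at (c q)))"
    using chart_derivative[OF assms] has_derivative_linear by blast
  then show ?thesis
    using True by (simp add: chart_field_def linear_add linear_scale algebra_simps)
qed (auto simp: chart_field_def)

text \<open>The derivation laws are those of the Frechet derivative at a point. Applied to a smooth
  \<open>f\<close>, the field gives \<open>b\<close> times a derivative of \<open>f\<close> in the
  chart, extended by zero; this is smooth since \<open>b\<close> vanishes off the compact set
  \<open>K\<close>.\<close>

lemma chart_field_vector_field:
  assumes M: "smooth_manifold M" "(U, c) \<in> charts M" and K: "compact K" "K \<subseteq> c ` U"
    and b: "\<And>k. Ck_on k (c ` U) b" and zero: "\<And>x. x \<in> c ` U - K \<Longrightarrow> b x = 0"
  shows "chart_field M U c b v \<in> vector_fields M"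
proof -
  let ?X = "chart_field M U c b v"
  note U = smooth_manifold_chart[OF M]
  have "?X q \<in> tangent_space M q" if "q \<in> pts M" for q
  proof (cases "q \<in> U")
    case True
    let ?i = "inv_into U c"
    let ?D = "\<lambda>f. frechet_derivative (\<lambda>x. f (?i x)) (at (c q))"
    note d = chart_derivative[OF M(2) True]
    have i: "?i (c q) = q" using True U(4) by simp
    have "?X q (\<lambda>q. s * f q + t * g q) = s * ?X q f + t * ?X q g"
      if f: "f \<in> smooth_functions M" and g: "g \<in> smooth_functions M" for f g s t
    proof -
      have "((\<lambda>x. s * f (?i x) + t * g (?i x)) has_derivative (\<lambda>v. s * ?D f v + t * ?D g v)) (at (c q))"
        by (intro has_derivative_add has_derivative_mult_right d f g)
      moreover have "(\<lambda>q. s * f q + t * g q) \<in> smooth_functions M"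
        by (intro smooth_functions_add smooth_functions_mult smooth_functions_const f g M)
      ultimately show ?thesis
        using True f g
        by (simp add: chart_field_def frechet_derivative_at[symmetric] algebra_simps)
    qed
    moreover have "?X q (\<lambda>q. f q * g q) = ?X q f * g q + f q * ?X q g"
      if f: "f \<in> smooth_functions M" and g: "g \<in> smooth_functions M" for f g
    proof -
      have "((\<lambda>x. f (?i x) * g (?i x)) has_derivative (\<lambda>v. f (?i (c q)) * ?D g v + ?D f v * g (?i (c q)))) (at (c q))"
        by (intro has_derivative_mult d f g)
      moreover have "(\<lambda>q. f q * g q) \<in> smooth_functions M"
        by (intro smooth_functions_mult f g M)
      ultimately show ?thesis
        using True f g i
        by (simp add: chart_field_def frechet_derivative_at[symmetric] algebra_simps)
    qed
    ultimately show ?thesis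
      by (simp add: tangent_space_def) (simp add: chart_field_def)
  qed (simp add: chart_field_def tangent_space_def)
  moreover have "?X q = 0" if "q \<notin> pts M" for q
    using that U(3) by (auto simp: chart_field_def fun_eq_iff)
  moreover have "(\<lambda>q. ?X q f) \<in> smooth_functions M" if f: "f \<in> smooth_functions M" for f
  proof -
    let ?u = "\<lambda>x. b x * frechet_derivative (\<lambda>x. f (inv_into U c x)) (at x) v"
    have "Ck_on k (c ` U) ?u" for k
      using smooth_functionsD[OF f M(2), of "Suc k"] by (intro Ck_on_mult U b) simp
    moreover have "?u x = 0" if "x \<in> c ` U - K" for x
      using zero[OF that] by simp
    ultimately have "(\<lambda>q. if q \<in> U then ?u (c q) else 0) \<in> smooth_functions M"
      by (rule chart_extension_smooth[OF M K])
    then show ?thesis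
      using f by (simp add: chart_field_def)
  qed
  ultimately show ?thesis by (simp add: vector_fields_def)
qed

lemma chart_field_nonzero:
  assumes M: "smooth_manifold M" "(U, c) \<in> charts M" and p: "p \<in> U"
    and r: "r > 0" "cball (c p) r \<subseteq> c ` U" and v: "v \<noteq> 0"
  shows "chart_field M U c (bump (c p) r) v p \<noteq> 0"
proof -
  let ?a = "c p" let ?b = "bump ?a r" let ?i = "inv_into U c"
  note U = smooth_manifold_chart[OF M]
  \<comment> \<open>The test function is the linear form \<open>(x - ?a) \<bullet> v\<close>, cut
    off so that it extends to all of \<open>M\<close>. The linear form vanishes at
    \<open>?a\<close>, which removes the term in which the bump is differentiated.\<close>
  define u where "u x = ?b x * ((x - ?a) \<bullet> v)" for x
  define f where "f q = (if q \<in> U then u (c q) else 0)" for q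
  have b: "Ck_on k S ?b" for k S
    using Ck_on_bump Ck_on_subset by blast
  have u: "Ck_on k (c ` U) u" for k
    unfolding u_def
    by (intro Ck_on_mult Ck_on_inner_const Ck_on_diff Ck_on_ident Ck_on_const b U)
  have f: "f \<in> smooth_functions M"
    unfolding f_def by (rule chart_extension_smooth[OF M compact_cball r(2) u])
      (use r in \<open>simp add: u_def bump_outside\<close>)
  have "((\<lambda>x. ?b x * ((x - ?a) \<bullet> v)) has_derivative
      (\<lambda>w. ?b ?a * (w \<bullet> v) + frechet_derivative ?b (at ?a) w * ((?a - ?a) \<bullet> v))) (at ?a)"
    using b[of "Suc 0" UNIV]
    by (intro has_derivative_mult)
      (auto intro!: derivative_eq_intros simp: frechet_derivative_works[symmetric])
  then have "(u has_derivative (\<lambda>w. ?b ?a * (w \<bullet> v))) (at ?a)"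
    by (simp add: u_def[abs_def])
  then have "((\<lambda>x. f (?i x)) has_derivative (\<lambda>w. ?b ?a * (w \<bullet> v))) (at ?a)"
    by (rule has_derivative_transform_within_open[OF _ U(2)])
      (use p in \<open>auto simp: f_def inv_into_into f_inv_into_f U(4)\<close>)
  then have "chart_field M U c ?b v p f = ?b ?a * (?b ?a * (v \<bullet> v))"
    using p f by (simp add: chart_field_def frechet_derivative_at[symmetric])
  moreover have "\<dots> > 0"
    using bump_centre[OF r(1), of ?a] v by simp
  ultimately show ?thesis by (metis less_irrefl zero_fun_apply)
qed

text \<open>Take the cut-off fields along two basis vectors \<open>i\<close> and \<open>j\<close>.
  If their values at \<open>p\<close> were \<open>a\<close> and \<open>b\<close> times
  \<open>w\<close>, the field along \<open>a *\<^sub>R j - b *\<^sub>R i\<close> would vanish at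
  \<open>p\<close>. By \<open>chart_field_nonzero\<close> that forces \<open>a = 0\<close>, and then
  the field along \<open>i\<close> vanishes at \<open>p\<close> too, which it does not.\<close>

lemma exists_independent_vector_field:
  fixes M :: "('m, 'e::euclidean_space) atlas_space"
  assumes M: "smooth_manifold M" and dim: "DIM('e) \<ge> 2" and p: "p \<in> pts M"
  obtains X where "X \<in> vector_fields M" "\<And>a. X p \<noteq> (\<lambda>f. a * w f)"
proof -
  obtain U c where U: "(U, c) \<in> charts M" "p \<in> U"
    using M p unfolding smooth_manifold_def by blast
  obtain r where r: "r > 0" "cball (c p) r \<subseteq> c ` U"
    using smooth_manifold_chart(2)[OF M U(1)] U(2) open_contains_cball by blast
  let ?X = "chart_field M U c (bump (c p) r)"
  have vf: "?X v \<in> vector_fields M" for v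
    by (rule chart_field_vector_field[OF M U(1) compact_cball r(2) Ck_on_subset[OF Ck_on_bump]])
      (use r bump_outside in auto)
  obtain i where i: "i \<in> (Basis :: 'e set)"
    using nonempty_Basis by blast
  moreover obtain j where j: "j \<in> (Basis :: 'e set)" "j \<noteq> i"
  proof (rule ccontr)
    assume "\<not> thesis"
    then have "(Basis :: 'e set) \<subseteq> {i}" using that by auto
    then show False using dim card_mono[of "{i}" "Basis :: 'e set"] by simp
  qed
  have "\<not> (?X i p = (\<lambda>f. a * w f) \<and> ?X j p = (\<lambda>f. b * w f))" for a b
  proof
    assume ab: "?X i p = (\<lambda>f. a * w f) \<and> ?X j p = (\<lambda>f. b * w f)"
    have "a *\<^sub>R j + (- b) *\<^sub>R i = 0"
    proof (rule ccontr)
      assume "a *\<^sub>R j + (- b) *\<^sub>R i \<noteq> 0"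
      then have "?X (a *\<^sub>R j + (- b) *\<^sub>R i) p \<noteq> 0"
        by (rule chart_field_nonzero[OF M U r])
      then show False
        using ab by (simp only: chart_field_linear[OF U(1)] fun_eq_iff) simp
    qed
    then have "(a *\<^sub>R j + (- b) *\<^sub>R i) \<bullet> j = 0" by simp
    then have "a = 0"
      using i j by (simp only: inner_add_left inner_scaleR_left) (simp add: inner_Basis)
    moreover have "?X i p \<noteq> 0"
      using i by (intro chart_field_nonzero[OF M U r]) auto
    ultimately show False using ab by (simp add: fun_eq_iff)
  qed
  then show ?thesis using that vf by metis
qed

section \<open>Almost coKaehler geometry\<close>

text \<open>The connection is a parameter, to be instantiated with the one hidden behind the
  existential in \<open>kappa_mu_almost_cokaehler\<close>.\<close>

locale almost_cokaehler_connection =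
  fixes n :: nat and M :: "('m, 'e::euclidean_space) atlas_space"
    and \<phi> :: "'m vfield \<Rightarrow> 'm vfield" and \<xi> :: "'m vfield"
    and \<eta> :: "'m vfield \<Rightarrow> 'm \<Rightarrow> real" and g :: "'m vfield \<Rightarrow> 'm vfield \<Rightarrow> 'm \<Rightarrow> real"
    and D :: "'m vfield \<Rightarrow> 'm vfield \<Rightarrow> 'm vfield"
  assumes almost_cokaehler: "almost_cokaehler n M \<phi> \<xi> \<eta> g"
    and levi_civita: "levi_civita M g D"
begin

section \<open>The defining properties as facts; closure and linearity rules\<close>

abbreviation "\<X> \<equiv> vector_fields M"
abbreviation S where "S X \<equiv> D X \<xi>"
abbreviation h where "h \<equiv> h_tensor \<phi> \<xi>"

lemma
  shows manifold: "smooth_manifold M" and metric: "riemannian_metric M g"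
    and xi: "\<xi> \<in> \<X>" and eta: "one_form M \<eta>" and phi: "tensor11 M \<phi>"
    and phi_phi: "X \<in> \<X> \<Longrightarrow> \<phi> (\<phi> X) = - X + \<eta> X *\<^sub>v \<xi>"
    and eta_xi: "p \<in> pts M \<Longrightarrow> \<eta> \<xi> p = 1"
    and g_phi_phi: "X \<in> \<X> \<Longrightarrow> Y \<in> \<X> \<Longrightarrow> p \<in> pts M \<Longrightarrow>
      g (\<phi> X) (\<phi> Y) p = g X Y p - \<eta> X p * \<eta> Y p"
    and d_eta: "X \<in> \<X> \<Longrightarrow> Y \<in> \<X> \<Longrightarrow> p \<in> pts M \<Longrightarrow> ext_deriv1 \<eta> X Y p = 0"
    and d_Phi: "X \<in> \<X> \<Longrightarrow> Y \<in> \<X> \<Longrightarrow> Z \<in> \<X> \<Longrightarrow> p \<in> pts M \<Longrightarrow>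
      ext_deriv2 (fundamental_form \<phi> g) X Y Z p = 0"
  using almost_cokaehler unfolding almost_cokaehler_def almost_contact_metric_def by blast+

lemma
  shows connection: "affine_connection M D"
    and bracket: "X \<in> \<X> \<Longrightarrow> Y \<in> \<X> \<Longrightarrow> lie_bracket X Y = D X Y - D Y X"
    and D_metric: "X \<in> \<X> \<Longrightarrow> Y \<in> \<X> \<Longrightarrow> Z \<in> \<X> \<Longrightarrow> p \<in> pts M \<Longrightarrow>
      vf_app X (g Y Z) p = g (D X Y) Z p + g Y (D X Z) p"
  using levi_civita unfolding levi_civita_def by metis+

lemmas add_vf [intro, simp] = vector_fields_add[OF manifold]
lemmas diff_vf [intro, simp] = vector_fields_diff[OF manifold]
lemmas minus_vf [intro, simp] = vector_fields_minus[OF manifold]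
lemmas scale_vf [intro, simp] = vector_fields_scale[OF manifold]
lemmas zero_vf [intro, simp] = vector_fields_0[OF manifold xi]
lemmas [intro, simp] = xi smooth_functions_const

lemma eta_smooth [intro, simp]: "X \<in> \<X> \<Longrightarrow> \<eta> X \<in> smooth_functions M"
  using eta by (simp add: one_form_def)

lemma phi_vf [intro, simp]: "X \<in> \<X> \<Longrightarrow> \<phi> X \<in> \<X>"
  using phi by (simp add: tensor11_def)

lemma D_vf [intro, simp]: "X \<in> \<X> \<Longrightarrow> Y \<in> \<X> \<Longrightarrow> D X Y \<in> \<X>"
  using connection by (simp add: affine_connection_def tensor11_def)

lemma bracket_vf [intro, simp]: "X \<in> \<X> \<Longrightarrow> Y \<in> \<X> \<Longrightarrow> lie_bracket X Y \<in> \<X>"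
  by (simp add: bracket)

lemma h_vf [intro, simp]: "X \<in> \<X> \<Longrightarrow> h X \<in> \<X>"
  by (simp add: h_tensor_def lie_deriv11_def)

lemma scale_zero: "a *\<^sub>v 0 = 0"
  by (simp add: vf_scale_def fun_eq_iff)

lemma minus_scale: "- X = (\<lambda>_. - 1) *\<^sub>v X"
  by (simp add: vf_scale_def fun_eq_iff)

lemma tensor11_add: "tensor11 M T \<Longrightarrow> X \<in> \<X> \<Longrightarrow> Y \<in> \<X> \<Longrightarrow> T (X + Y) = T X + T Y"
  and tensor11_scale: "tensor11 M T \<Longrightarrow> a \<in> smooth_functions M \<Longrightarrow> X \<in> \<X> \<Longrightarrow>
    T (a *\<^sub>v X) = a *\<^sub>v T X"
  by (simp_all add: tensor11_def)

lemma tensor11_minus: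
  assumes "tensor11 M T" "X \<in> \<X>"
  shows "T (- X) = - T X"
  using assms minus_scale[of X] minus_scale[of "T X"] by (simp add: tensor11_def)

lemma tensor11_diff:
  assumes "tensor11 M T" "X \<in> \<X>" "Y \<in> \<X>"
  shows "T (X - Y) = T X - T Y"
proof -
  have "T (X + - Y) = T X + T (- Y)"
    using assms by (intro tensor11_add minus_vf)
  then show ?thesis using tensor11_minus[OF assms(1,3)] by simp
qed

lemma tensor11_0: "tensor11 M T \<Longrightarrow> T 0 = 0"
  using tensor11_diff[of T \<xi> \<xi>] by simp

lemma D_tensor: "Y \<in> \<X> \<Longrightarrow> tensor11 M (\<lambda>X. D X Y)"
  using connection by (simp add: affine_connection_def)

lemma D_add: "X \<in> \<X> \<Longrightarrow> Y \<in> \<X> \<Longrightarrow> Z \<in> \<X> \<Longrightarrow> D X (Y + Z) = D X Y + D X Z"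
  and D_scale: "X \<in> \<X> \<Longrightarrow> Y \<in> \<X> \<Longrightarrow> a \<in> smooth_functions M \<Longrightarrow>
    D X (a *\<^sub>v Y) = vf_app X a *\<^sub>v Y + a *\<^sub>v D X Y"
  using connection by (simp_all add: affine_connection_def)

lemma D_0: "X \<in> \<X> \<Longrightarrow> D X 0 = 0"
  using D_add[of X 0 0] by simp

lemma D_diff: "X \<in> \<X> \<Longrightarrow> Y \<in> \<X> \<Longrightarrow> Z \<in> \<X> \<Longrightarrow> D X (Y - Z) = D X Y - D X Z"
  using D_add[of X "Y - Z" Z] by (simp add: algebra_simps)

lemma D_minus: "X \<in> \<X> \<Longrightarrow> Y \<in> \<X> \<Longrightarrow> D X (- Y) = - D X Y"
  using D_diff[of X 0 Y] by (simp add: D_0)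

lemma one_form_0: "one_form M \<alpha> \<Longrightarrow> p \<in> pts M \<Longrightarrow> \<alpha> 0 p = 0"
  using one_form_diff[OF manifold, of \<alpha> \<xi> \<xi> p] by simp

lemma
  assumes "p \<in> pts M" "X \<in> \<X>" "Y \<in> \<X>" "Z \<in> \<X>"
  shows g_sym: "g X Y p = g Y X p"
    and g_add_left: "g (X + Y) Z p = g X Z p + g Y Z p"
    and g_add_right: "g X (Y + Z) p = g X Y p + g X Z p"
    and g_diff_left: "g (X - Y) Z p = g X Z p - g Y Z p"
    and g_diff_right: "g X (Y - Z) p = g X Y p - g X Z p"
    and g_minus_left: "g (- X) Z p = - g X Z p"
    and g_minus_right: "g X (- Z) p = - g X Z p"
    and g_scale_left: "a \<in> smooth_functions M \<Longrightarrow> g (a *\<^sub>v X) Y p = a p * g X Y p"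
    and g_scale_right: "a \<in> smooth_functions M \<Longrightarrow> g X (a *\<^sub>v Y) p = a p * g X Y p"
proof -
  show "g X Y p = g Y X p"
    using metric assms by (simp add: riemannian_metric_def)
  have l: "one_form M (\<lambda>X. g X Z)" and r: "one_form M (g Z)" if "Z \<in> \<X>" for Z
    using metric that by (simp_all add: riemannian_metric_def tensor02_def)
  note l = l[OF assms(3)] l[OF assms(4)] and r = r[OF assms(2)] and p = assms(1)
  note diff = one_form_diff[OF manifold _ _ _ p]
  show "g (X + Y) Z p = g X Z p + g Y Z p"
    using l(2) assms by (simp add: one_form_def)
  show "g X (Y + Z) p = g X Y p + g X Z p"
    using r assms by (simp add: one_form_def)
  show "a \<in> smooth_functions M \<Longrightarrow> g (a *\<^sub>v X) Y p = a p * g X Y p"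
    using l(1) assms by (simp add: one_form_def)
  show "a \<in> smooth_functions M \<Longrightarrow> g X (a *\<^sub>v Y) p = a p * g X Y p"
    using r assms by (simp add: one_form_def)
  show "g (X - Y) Z p = g X Z p - g Y Z p" "g X (Y - Z) p = g X Y p - g X Z p"
    by (rule diff[OF l(2) assms(2,3)], rule diff[OF r assms(3,4)])
  have "g (0 - X) Z p = g 0 Z p - g X Z p" "g X (0 - Z) p = g X 0 p - g X Z p"
    by (rule diff[OF l(2) zero_vf assms(2)], rule diff[OF r zero_vf assms(4)])
  then show "g (- X) Z p = - g X Z p" "g X (- Z) p = - g X Z p"
    using one_form_0[OF l(2) p] one_form_0[OF r p] by simp_all
qed

lemma
  assumes "p \<in> pts M" "X \<in> \<X>"
  shows g_0_left: "g 0 X p = 0" and g_0_right: "g X 0 p = 0"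
  using g_diff_left[of p X X X] g_diff_right[of p X X X] assms by simp_all

lemmas g_simps = g_add_left g_add_right g_diff_left g_diff_right g_minus_left g_minus_right
  g_scale_left g_scale_right g_0_left g_0_right

section \<open>Positivity of the metric, and differentiation of scalar identities\<close>

lemma g_pos: "X \<in> \<X> \<Longrightarrow> p \<in> pts M \<Longrightarrow> X p \<noteq> 0 \<Longrightarrow> g X X p > 0"
  using metric by (simp add: riemannian_metric_def)

lemma g_nonneg:
  assumes Z: "Z \<in> \<X>" and W: "W \<in> \<X>" and p: "p \<in> pts M" and Wp: "W p \<noteq> 0"
  shows "g Z Z p \<ge> 0"
proof (cases "Z p = 0")
  case True
  \<comment> \<open>Positivity is only assumed where a field does not vanish, so perturb \<open>Z\<close> by \<open>\<plusminus> t W\<close>.\<close>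
  have pos: "g Z Z p + 2 * t * g Z W p + t * t * g W W p > 0" if "t \<noteq> 0" for t
  proof -
    let ?Y = "Z + (\<lambda>_. t) *\<^sub>v W"
    have "?Y p \<noteq> 0"
      using True Wp that by (auto simp: vf_scale_def fun_eq_iff)
    then have "g ?Y ?Y p > 0"
      using Z W p by (intro g_pos) auto
    then show ?thesis
      using Z W p g_sym[of p Z W Z] by (simp add: g_simps algebra_simps)
  qed
  show ?thesis
  proof (rule ccontr)
    assume neg: "\<not> ?thesis"
    \<comment> \<open>With this \<open>t\<close> the quadratic terms cancel \<open>g Z Z p\<close>,
      so the two expressions for \<open>t\<close> and \<open>- t\<close> add up to 0, although both
      are positive.\<close>
    define t where "t = sqrt (- g Z Z p / g W W p)"
    have w: "g W W p > 0"
      by (rule g_pos[OF W p Wp])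
    then have "t * t * g W W p = - g Z Z p" "t \<noteq> 0"
      using neg by (auto simp: t_def)
    then show False
      using pos[of t] pos[of "- t"] by simp
  qed
next
  case False
  then show ?thesis using g_pos[OF Z p] by simp
qed

text \<open>Scalar identities are known on \<open>pts M\<close> only; this allows them to be
  differentiated.\<close>

lemma vf_app_cong:
  assumes "X \<in> \<X>" "p \<in> pts M" "\<And>q. q \<in> pts M \<Longrightarrow> a q = b q"
  shows "vf_app X a p = vf_app X b p"
  unfolding vf_app_def
  by (rule tangent_space_cong[OF manifold vector_fieldsD(1)[OF assms(1,2)] assms(2,3)])

lemma vf_app_const: "X \<in> \<X> \<Longrightarrow> p \<in> pts M \<Longrightarrow> vf_app X (\<lambda>_. a) p = 0"
  unfolding vf_app_def by (rule tangent_space_const[OF vector_fieldsD(1)])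

section \<open>Algebra of the almost contact structure\<close>

lemma phi_xi: "\<phi> \<xi> = 0"
proof -
  \<comment> \<open>Outside \<open>pts M\<close> the value of \<open>\<eta> \<xi>\<close> is
    arbitrary, but there \<open>\<xi>\<close> is 0.\<close>
  have "\<eta> \<xi> p * \<xi> p f = \<xi> p f" for p f
    using eta_xi[of p] vector_fieldsD(2)[OF xi, of p] by (cases "p \<in> pts M") auto
  then have 0: "\<phi> (\<phi> \<xi>) = 0"
    by (simp add: phi_phi vf_scale_def fun_eq_iff)
  \<comment> \<open>The cube of \<open>\<phi>\<close> kills \<open>\<xi>\<close>, so
    \<open>\<phi> \<xi>\<close> is c times \<open>\<xi>\<close> with c =
    \<open>\<eta> (\<phi> \<xi>)\<close>. A further \<open>\<phi>\<close> makes c times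
    \<open>\<phi> \<xi>\<close> zero; so at each point c or \<open>\<phi> \<xi>\<close> vanishes,
    and in the first case \<open>\<phi> \<xi>\<close>, being c times \<open>\<xi>\<close>, vanishes
    as well.\<close>
  have "\<phi> (\<phi> (\<phi> \<xi>)) = - \<phi> \<xi> + \<eta> (\<phi> \<xi>) *\<^sub>v \<xi>"
    by (rule phi_phi) simp
  then have 1: "\<phi> \<xi> = \<eta> (\<phi> \<xi>) *\<^sub>v \<xi>"
    using 0 tensor11_0[OF phi] by (simp add: add_eq_0_iff)
  moreover have "\<phi> (\<eta> (\<phi> \<xi>) *\<^sub>v \<xi>) = \<eta> (\<phi> \<xi>) *\<^sub>v \<phi> \<xi>"
    using phi by (simp add: tensor11_def)
  ultimately have 2: "\<eta> (\<phi> \<xi>) *\<^sub>v \<phi> \<xi> = 0"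
    using 0 by metis
  have "\<eta> (\<phi> \<xi>) p * \<phi> \<xi> p f = 0" for p f
    using fun_cong[OF fun_cong[OF 2, of p], of f] by (simp add: vf_scale_def)
  moreover have "\<phi> \<xi> p f = \<eta> (\<phi> \<xi>) p * \<xi> p f" for p f
    using fun_cong[OF fun_cong[OF 1]] by (simp add: vf_scale_def)
  ultimately have "\<phi> \<xi> p f = 0" for p f
    by (metis mult_eq_0_iff)
  then show ?thesis by (simp add: fun_eq_iff)
qed

text \<open>Computing the cube of \<open>\<phi>\<close> at \<open>X\<close> with
  \<open>phi_phi\<close> inside and then outside gives two results that differ by
  \<open>\<eta> (\<phi> X) *\<^sub>v \<xi>\<close>.\<close>

lemma eta_phi:
  assumes X: "X \<in> \<X>" and p: "p \<in> pts M"
  shows "\<eta> (\<phi> X) p = 0"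
proof -
  have "\<phi> (- X + \<eta> X *\<^sub>v \<xi>) = \<phi> (- X) + \<eta> X *\<^sub>v \<phi> \<xi>"
    using X by (simp only: tensor11_add[OF phi] tensor11_scale[OF phi] minus_vf scale_vf eta_smooth xi)
  also have "\<dots> = - \<phi> X"
    using X by (simp add: tensor11_minus[OF phi] phi_xi scale_zero)
  finally have "\<eta> (\<phi> X) *\<^sub>v \<xi> = 0"
    using phi_phi[of "\<phi> X"] X by (simp add: phi_phi)
  moreover have "\<eta> (\<eta> (\<phi> X) *\<^sub>v \<xi>) p = \<eta> (\<phi> X) p * \<eta> \<xi> p"
    using eta X p by (simp add: one_form_def)
  ultimately show ?thesis
    using one_form_0[OF eta p] eta_xi[OF p] by simp
qed

lemma g_xi:
  assumes X: "X \<in> \<X>" and p: "p \<in> pts M"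
  shows "g X \<xi> p = \<eta> X p"
  using g_phi_phi[OF X xi p] g_0_right[OF p, of "\<phi> X"] assms by (simp add: phi_xi eta_xi)

text \<open>Compatibility of \<open>g\<close> with \<open>\<phi>\<close> for the pair
  \<open>X\<close>, \<open>\<phi> Y\<close>; the terms with \<open>\<eta>\<close> vanish by
  \<open>eta_phi\<close>.\<close>

lemma g_phi_skew:
  assumes X: "X \<in> \<X>" and Y: "Y \<in> \<X>" and p: "p \<in> pts M"
  shows "g (\<phi> X) Y p = - g X (\<phi> Y) p"
  using g_phi_phi[OF X phi_vf[OF Y] p] assms by (simp add: phi_phi g_simps g_xi eta_phi)

section \<open>The covariant derivative of the Reeb field\<close>

lemma g_S_xi:
  assumes X: "X \<in> \<X>" and p: "p \<in> pts M"
  shows "g (S X) \<xi> p = 0"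
proof -
  have "vf_app X (g \<xi> \<xi>) p = vf_app X (\<lambda>_. 1) p"
    using assms by (intro vf_app_cong) (auto simp: g_xi eta_xi)
  then show ?thesis
    using D_metric[OF X xi xi p] g_sym[of p "S X" \<xi> \<xi>] assms by (simp add: vf_app_const)
qed

text \<open>As \<open>\<eta>\<close> is the pairing with \<open>\<xi>\<close>, metric compatibility
  turns \<open>d_eta\<close> into the difference of the two sides: the terms with
  \<open>D X Y\<close> and \<open>D Y X\<close> cancel against the bracket.\<close>

lemma S_symmetric:
  assumes X: "X \<in> \<X>" and Y: "Y \<in> \<X>" and p: "p \<in> pts M"
  shows "g (S X) Y p = g X (S Y) p"
proof -
  have "vf_app X (\<eta> Y) p = g (D X Y) \<xi> p + g Y (S X) p" if "X \<in> \<X>" "Y \<in> \<X>" for X Y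
    using vf_app_cong[OF that(1) p, of "\<eta> Y" "g Y \<xi>"] D_metric[OF that xi p] that
    by (simp add: g_xi)
  moreover have "\<eta> (lie_bracket X Y) p = g (D X Y) \<xi> p - g (D Y X) \<xi> p"
    using g_xi[of "lie_bracket X Y" p] assms by (simp add: bracket g_diff_left)
  ultimately show ?thesis
    using d_eta[OF X Y p] g_sym[of p Y "S X" X] assms by (simp add: ext_deriv1_def)
qed

text \<open>Symmetry moves one \<open>S\<close> of \<open>g (S \<xi>) (S \<xi>)\<close> over,
  leaving a product with \<open>\<xi>\<close> that is 0 by \<open>g_S_xi\<close>. Geometrically, the
  integral curves of \<open>\<xi>\<close> are geodesics.\<close>

lemma S_xi: "S \<xi> = 0"
proof (rule ext)
  fix p
  show "S \<xi> p = 0 p"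
  proof (cases "p \<in> pts M")
    case True
    have "g (S \<xi>) (S \<xi>) p = g \<xi> (S (S \<xi>)) p"
      using True by (intro S_symmetric) auto
    also have "\<dots> = 0"
      using g_S_xi[of "S \<xi>" p] g_sym[of p \<xi> "S (S \<xi>)" \<xi>] True by simp
    finally show ?thesis
      using g_pos[of "S \<xi>" p] True by force
  next
    case False
    then show ?thesis using vector_fieldsD(2)[OF D_vf[OF xi xi]] by simp
  qed
qed

section \<open>The Lie derivative of the metric and the tensor \<open>h\<close>\<close>

lemma lie_deriv_g:
  assumes X: "X \<in> \<X>" and Y: "Y \<in> \<X>" and p: "p \<in> pts M"
  shows "lie_deriv02 \<xi> g X Y p = 2 * g (S X) Y p"
  using D_metric[OF xi X Y p] S_symmetric[OF assms] assms
  by (simp add: lie_deriv02_def bracket g_simps)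

text \<open>Since \<open>\<Phi>\<close> vanishes when one argument is \<open>\<xi>\<close>,
  closedness at (\<open>\<xi>\<close>, \<open>X\<close>, \<open>Y\<close>) says that the Lie
  derivative of \<open>\<Phi>\<close> along \<open>\<xi>\<close> is 0. By the product rule for
  \<open>\<Phi>\<close> = g(., \<open>\<phi>\<close> .), the Lie derivative of \<open>g\<close> at
  (\<open>X\<close>, \<open>\<phi> Y\<close>) is then -2 \<open>g X (h Y)\<close>, and
  \<open>lie_deriv_g\<close> evaluates it.\<close>

lemma g_h:
  assumes X: "X \<in> \<X>" and Y: "Y \<in> \<X>" and p: "p \<in> pts M"
  shows "g X (h Y) p = - g (S X) (\<phi> Y) p"
proof -
  let ?\<Phi> = "fundamental_form \<phi> g"
  have "vf_app X (?\<Phi> \<xi> Y) p = 0" if "X \<in> \<X>" "Y \<in> \<X>" for X Y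
  proof -
    have "vf_app X (?\<Phi> \<xi> Y) p = vf_app X (\<lambda>_. 0) p"
      using that p g_sym[of _ \<xi> "\<phi> Y" \<xi>]
      by (intro vf_app_cong) (auto simp: fundamental_form_def g_xi eta_phi)
    then show ?thesis using that p by (simp add: vf_app_const)
  qed
  moreover have "?\<Phi> (lie_bracket X Y) \<xi> p = 0"
    using assms by (simp add: fundamental_form_def phi_xi g_0_right)
  moreover have "?\<Phi> (lie_bracket \<xi> Y) X p = - g X (\<phi> (lie_bracket \<xi> Y)) p"
    using g_phi_skew[of "lie_bracket \<xi> Y" X p] g_sym[of p X "\<phi> (lie_bracket \<xi> Y)" X] assms
    by (simp add: fundamental_form_def)
  moreover have "?\<Phi> X Y = g X (\<phi> Y)"
    by (rule ext) (simp add: fundamental_form_def)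
  ultimately have "vf_app \<xi> (g X (\<phi> Y)) p - g (lie_bracket \<xi> X) (\<phi> Y) p
      - g X (\<phi> (lie_bracket \<xi> Y)) p = 0"
    using d_Phi[OF xi X Y p] assms
    by (simp add: ext_deriv2_def) (simp add: fundamental_form_def)
  moreover have "g X (h Y) p = 1 / 2 * (g X (lie_bracket \<xi> (\<phi> Y)) p - g X (\<phi> (lie_bracket \<xi> Y)) p)"
    using assms by (simp add: h_tensor_def lie_deriv11_def g_simps)
  ultimately show ?thesis
    using lie_deriv_g[OF X phi_vf[OF Y] p] by (simp add: lie_deriv02_def)
qed

text \<open>The failure of \<open>h\<close> and \<open>\<phi>\<close> to anticommute is a multiple
  of \<open>\<xi>\<close>; pairing with a field orthogonal to \<open>\<xi>\<close> at
  \<open>p\<close> discards it.\<close>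

lemma g_h_phi:
  assumes X: "X \<in> \<X>" and Y: "Y \<in> \<X>" and p: "p \<in> pts M" and Y0: "\<eta> Y p = 0"
  shows "g (h (\<phi> X)) Y p = - g (\<phi> (h X)) Y p"
proof -
  let ?L = "lie_deriv11 \<xi> \<phi>"
  let ?B = "lie_bracket \<xi> X"
  have a: "vf_app \<xi> (\<eta> X) \<in> smooth_functions M"
    using X vector_fieldsD(3)[OF xi] by simp
  have "D \<xi> (\<phi> (\<phi> X)) = - D \<xi> X + vf_app \<xi> (\<eta> X) *\<^sub>v \<xi>"
    using D_add[OF xi minus_vf[OF X] scale_vf[OF eta_smooth[OF X] xi]]
      D_scale[OF xi xi eta_smooth[OF X]] D_minus[OF xi X] phi_phi[OF X]
    by (simp only: S_xi scale_zero add_0_right)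
  moreover have "S (\<phi> (\<phi> X)) = - S X"
    using tensor11_add[OF D_tensor[OF xi] minus_vf[OF X] scale_vf[OF eta_smooth[OF X] xi]]
      tensor11_scale[OF D_tensor[OF xi] eta_smooth[OF X] xi] tensor11_minus[OF D_tensor[OF xi] X]
      phi_phi[OF X]
    by (simp only: S_xi scale_zero add_0_right)
  ultimately have br: "lie_bracket \<xi> (\<phi> (\<phi> X)) = - ?B + vf_app \<xi> (\<eta> X) *\<^sub>v \<xi>"
    using X by (simp add: bracket)
  have h: "g (h Z) Y p = 1 / 2 * g (?L Z) Y p" "g (\<phi> (h Z)) Y p = 1 / 2 * g (\<phi> (?L Z)) Y p"
    if "Z \<in> \<X>" for Z
  proof -
    have L: "?L Z \<in> \<X>" using that by (simp add: lie_deriv11_def)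
    moreover have "\<phi> (h Z) = (\<lambda>_. 1 / 2) *\<^sub>v \<phi> (?L Z)"
      using phi L unfolding h_tensor_def tensor11_def by simp
    ultimately show "g (h Z) Y p = 1 / 2 * g (?L Z) Y p"
      "g (\<phi> (h Z)) Y p = 1 / 2 * g (\<phi> (?L Z)) Y p"
      using Y p by (simp_all add: h_tensor_def g_scale_left)
  qed
  \<comment> \<open>The two copies of \<open>\<phi> (lie_bracket \<xi> (\<phi> X))\<close> cancel,
    which leaves the Lie derivative of the square of \<open>\<phi>\<close>.\<close>
  have "?L (\<phi> X) + \<phi> (?L X) = lie_bracket \<xi> (\<phi> (\<phi> X)) - \<phi> (\<phi> ?B)"
    using X by (simp add: lie_deriv11_def tensor11_diff[OF phi])
  also have "\<dots> = vf_app \<xi> (\<eta> X) *\<^sub>v \<xi> - \<eta> ?B *\<^sub>v \<xi>"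
    by (simp only: br phi_phi[OF bracket_vf[OF xi X]]) simp
  finally have "g (?L (\<phi> X) + \<phi> (?L X)) Y p
      = g (vf_app \<xi> (\<eta> X) *\<^sub>v \<xi> - \<eta> ?B *\<^sub>v \<xi>) Y p" by simp
  also have "\<dots> = 0"
    using X Y p a Y0 g_sym[of p \<xi> Y \<xi>] by (simp add: g_simps g_xi)
  finally have "g (?L (\<phi> X)) Y p + g (\<phi> (?L X)) Y p = 0"
    using X Y p by (subst (asm) g_add_left) (auto simp: lie_deriv11_def)
  then show ?thesis using h(1)[OF phi_vf[OF X]] h(2)[OF X] by simp
qed

lemma h_phi_phi:
  assumes X: "X \<in> \<X>" and p: "p \<in> pts M" and X0: "\<eta> X p = 0"
  shows "g (h (\<phi> X)) (\<phi> X) p = - g (h X) X p"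
  using g_h_phi[OF X phi_vf[OF X] p eta_phi[OF X p]] g_phi_phi[of "h X" X p] assms by simp

text \<open>The relation \<open>g_h\<close> trades \<open>S\<close> for \<open>h\<close>, the
  anticommutation of \<open>h\<close> with \<open>\<phi>\<close> is applied, and \<open>g_h\<close>
  trades back.\<close>

lemma S_phi_phi:
  assumes X: "X \<in> \<X>" and p: "p \<in> pts M" and X0: "\<eta> X p = 0"
  shows "g (S (\<phi> X)) (\<phi> X) p = - g (S X) X p"
proof -
  have "g (S X) X p = - g (S X) (\<phi> (\<phi> X)) p"
    using assms by (simp add: phi_phi g_simps)
  also have "\<dots> = g X (h (\<phi> X)) p"
    using g_h[of X "\<phi> X" p] assms by simp
  also have "\<dots> = - g (\<phi> (h X)) X p"
    using g_h_phi[OF X X p X0] g_sym[of p X "h (\<phi> X)" X] assms by simp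
  also have "\<dots> = g (\<phi> X) (h X) p"
    using g_phi_skew[of "h X" X p] g_sym[of p "h X" "\<phi> X" X] assms by simp
  also have "\<dots> = - g (S (\<phi> X)) (\<phi> X) p"
    using g_h[of "\<phi> X" X p] assms by simp
  finally show ?thesis by simp
qed

section \<open>The second Lie derivative of the metric, and curvature\<close>

lemma lie_deriv_lie_deriv_g:
  assumes X: "X \<in> \<X>" and p: "p \<in> pts M"
  shows "lie_deriv02 \<xi> (lie_deriv02 \<xi> g) X X p
    = 2 * (g (D \<xi> (S X)) X p - g (S (D \<xi> X)) X p + g (S (S X)) X p + g (S X) (S X) p)"
proof -
  \<comment> \<open>The factor 2 from \<open>lie_deriv_g\<close> is absorbed into the field as a
    constant function, so that \<open>D_metric\<close> applies.\<close>
  have "vf_app \<xi> (lie_deriv02 \<xi> g X X) p = vf_app \<xi> (g ((\<lambda>_. 2) *\<^sub>v S X) X) p"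
    using assms by (intro vf_app_cong) (auto simp: lie_deriv_g g_scale_left)
  also have "\<dots> = g (D \<xi> ((\<lambda>_. 2) *\<^sub>v S X)) X p + g ((\<lambda>_. 2) *\<^sub>v S X) (D \<xi> X) p"
    using assms by (intro D_metric) auto
  also have "\<dots> = g (vf_app \<xi> (\<lambda>_. 2) *\<^sub>v S X + (\<lambda>_. 2) *\<^sub>v D \<xi> (S X)) X p
      + g ((\<lambda>_. 2) *\<^sub>v S X) (D \<xi> X) p"
    by (simp only: D_scale[OF xi D_vf[OF X xi] smooth_functions_const])
  also have "\<dots> = 2 * (g (D \<xi> (S X)) X p + g (S X) (D \<xi> X) p)"
    using assms vector_fieldsD(3)[OF xi, of "\<lambda>_. 2"] by (simp add: g_simps vf_app_const)
  finally have "vf_app \<xi> (lie_deriv02 \<xi> g X X) p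
      = 2 * (g (D \<xi> (S X)) X p + g (S X) (D \<xi> X) p)" .
  then show ?thesis
    using assms
    by (simp add: lie_deriv02_def[of _ "lie_deriv02 \<xi> g"] lie_deriv_g bracket
        tensor11_diff[OF D_tensor[OF xi]] g_simps)
qed

text \<open>As \<open>S \<xi> = 0\<close>, one curvature term drops out. What remains is minus the
  first three terms in \<open>lie_deriv_lie_deriv_g\<close>, which therefore cancel when the two are
  added.\<close>

lemma curvature_xi:
  assumes X: "X \<in> \<X>" and p: "p \<in> pts M"
  shows "g (curvature D X \<xi> \<xi>) X p = g (S (D \<xi> X)) X p - g (D \<xi> (S X)) X p - g (S (S X)) X p"
  using assms
  by (simp add: curvature_def bracket S_xi D_0 tensor11_diff[OF D_tensor[OF xi]] g_simps)

end

theorem theorem13: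
  fixes M :: "('m, 'e::euclidean_space) atlas_space"
    and \<phi> :: "'m vfield \<Rightarrow> 'm vfield" and \<xi> :: "'m vfield"
    and \<eta> :: "'m vfield \<Rightarrow> 'm \<Rightarrow> real" and g :: "'m vfield \<Rightarrow> 'm vfield \<Rightarrow> 'm \<Rightarrow> real"
    and \<kappa> \<mu> :: "'m \<Rightarrow> real" and n :: nat
  assumes "non_cokaehler_kappa_mu n M \<phi> \<xi> \<eta> g \<kappa> \<mu>"
  shows "\<not> mixed_killing M g \<xi>"
proof
  assume "mixed_killing M g \<xi>"
  \<comment> \<open>The point \<open>p\<close> is one where the factor does not vanish; the argument
    takes place there.\<close>
  then obtain f p where p: "p \<in> pts M"
    and f: "\<And>X Y p. X \<in> vector_fields M \<Longrightarrow> Y \<in> vector_fields M \<Longrightarrow> p \<in> pts M \<Longrightarrow>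
      lie_deriv02 \<xi> (lie_deriv02 \<xi> g) X Y p = f p * lie_deriv02 \<xi> g X Y p"
    unfolding mixed_killing_def by blast
  obtain D where ac: "almost_cokaehler n M \<phi> \<xi> \<eta> g" and D: "levi_civita M g D"
    and \<kappa>: "\<kappa> \<in> smooth_functions M" and \<mu>: "\<mu> \<in> smooth_functions M"
    and neg: "\<kappa> p < 0"
    and R: "\<And>X Y. X \<in> vector_fields M \<Longrightarrow> Y \<in> vector_fields M \<Longrightarrow> curvature D X Y \<xi> =
             \<kappa> *\<^sub>v (\<eta> Y *\<^sub>v X - \<eta> X *\<^sub>v Y) +
             \<mu> *\<^sub>v (\<eta> Y *\<^sub>v h_tensor \<phi> \<xi> X - \<eta> X *\<^sub>v h_tensor \<phi> \<xi> Y)"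
    using assms p unfolding non_cokaehler_kappa_mu_def kappa_mu_almost_cokaehler_def by blast
  interpret almost_cokaehler_connection n M \<phi> \<xi> \<eta> g D
    by unfold_locales (fact ac D)+
  have dim: "DIM('e) \<ge> 2"
    using ac by (simp add: almost_cokaehler_def almost_contact_metric_def)
  obtain Z where Z: "Z \<in> \<X>" "\<And>a. Z p \<noteq> (\<lambda>f. a * \<xi> p f)"
    using exists_independent_vector_field[OF manifold dim p, where w = "\<xi> p"] by blast
  \<comment> \<open>The part of \<open>Z\<close> orthogonal to \<open>\<xi>\<close>; it is nonzero
    at \<open>p\<close> because \<open>Z p\<close> is no multiple of \<open>\<xi> p\<close>.\<close>
  define X where "X = Z - \<eta> Z *\<^sub>v \<xi>"
  have X: "X \<in> \<X>"
    using Z by (simp add: X_def)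
  have "X p \<noteq> 0"
    using Z(2)[of "\<eta> Z p"] by (auto simp: X_def vf_scale_def fun_eq_iff)
  then have pos: "g X X p > 0"
    by (rule g_pos[OF X p])
  have X0: "\<eta> X p = 0"
    using one_form_diff[OF manifold eta Z(1) scale_vf[OF eta_smooth[OF Z(1)] xi] p] eta Z(1) p
    by (simp add: X_def one_form_def eta_xi)
  \<comment> \<open>Half the mixed Killing equation plus the curvature condition: all terms with
    \<open>D \<xi>\<close> cancel.\<close>
  have key: "g (S Y) (S Y) p - \<kappa> p * g Y Y p - \<mu> p * g (h Y) Y p = f p * g (S Y) Y p"
    if Y: "Y \<in> \<X>" and Y0: "\<eta> Y p = 0" for Y
  proof -
    have "g (curvature D Y \<xi> \<xi>) Y p = \<kappa> p * g Y Y p + \<mu> p * g (h Y) Y p"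
      using Y p \<kappa> \<mu> Y0 by (simp add: R g_simps eta_xi)
    then show ?thesis
      using f[OF Y Y p] Y p
      by (simp add: curvature_xi lie_deriv_lie_deriv_g lie_deriv_g)
  qed
  \<comment> \<open>Replacing \<open>X\<close> by \<open>\<phi> X\<close> flips the sign of the
    \<open>\<mu>\<close> and \<open>f\<close> terms and keeps the \<open>\<kappa>\<close>
    term.\<close>
  have "g (S X) (S X) p + g (S (\<phi> X)) (S (\<phi> X)) p = 2 * \<kappa> p * g X X p"
    using key[OF X X0] key[OF phi_vf[OF X] eta_phi[OF X p]]
      h_phi_phi[OF X p X0] S_phi_phi[OF X p X0] g_phi_phi[OF X X p] X0
    by simp
  moreover have "g (S Y) (S Y) p \<ge> 0" if "Y \<in> \<X>" for Y
    using that by (intro g_nonneg[OF _ X p \<open>X p \<noteq> 0\<close>]) auto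
  then have "g (S X) (S X) p + g (S (\<phi> X)) (S (\<phi> X)) p \<ge> 0"
    using X by (intro add_nonneg_nonneg) auto
  moreover have "\<kappa> p * g X X p < 0"
    using neg pos by (rule mult_neg_pos)
  ultimately show False by simp
qed

end
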